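(* Let $\Delta$ be a semiregular right-angled building over a finite index set $I$ with a fixed legal coloring $\lambda$. Let $C\subseteq\Delta$ be panel-closed. Let $\mathbf F=(F_i)_{i\in I}$ be local data over $I$, and let $g\in\operatorname{Aut}(\Delta)$ be an automorphism mapping each chamber in $C$ to a chamber harmonious with it (with respect to $\mathbf F$). Then there exists an automorphism $h\in\operatorname{Aut}(\Delta)$ with the following properties: (i) $g|_C=h|_C$; (ii) for each $i\in I$ and for each $i$-panel $\mathcal P$, either $\mathcal P$ is parallel to a panel contained in $C$, or $\sigma_\lambda(h,\mathcal P)\in F_i$ (or both). In particular, $h$ maps every chamber of $\Delta$ to a chamber harmonious with it.
   Context: Let $I$ be a finite set and $M=(m_{ij})_{i,j\in I}$ a right-angled Coxeter matrix: $m_{ii}=1$ and $m_{ij}\in\{2,\infty\}$ for $i\neq j$. $\Delta$ is a semiregular right-angled building of type $M$ with parameters $(q_i)_{i\in I}$ (each $i$-panel, i.e. residue of type $\{i\}$, has exactly $q_i$ chambers; the $q_i\ge 2$ may be infinite cardinals); it is identified with its set of chambers. $\operatorname{Aut}(\Delta)$ is the group of type-preserving automorphisms. Legal coloring: for each $i$ let $\Omega_i$ be a set of cardinality $q_i$; a legal coloring is a map $\lambda=(\lambda_i)_{i\in I}\colon\Delta\to\prod_{i\in I}\Omega_i$ such that for each $i$-panel $\mathcal P$ the restriction $\lambda_i|_{\mathcal P}\colon \mathcal P\to\Omega_i$ is a bijection and $\lambda_j|_{\mathcal P}$ is constant for every $j\neq i$. The local action of $g\in\operatorname{Aut}(\Delta)$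 at an $i$-panel $\mathcal P$ is $\sigma_\lambda(g,\mathcal P)=\lambda_i|_{g\mathcal P}\circ g|_{\mathcal P}\circ(\lambda_i|_{\mathcal P})^{-1}\in\operatorname{Sym}(\Omega_i)$. Local data $\mathbf F$: a family of permutation groups $F_i\leq\operatorname{Sym}(\Omega_i)$, $i\in I$. Two chambers $c,c'$ are harmonious (with respect to $\mathbf F$) if for each $k\in I$ the colors $\lambda_k(c)$ and $\lambda_k(c')$ lie in the same $F_k$-orbit. Two residues $\mathcal R_1,\mathcal R_2$ are parallel if $\operatorname{proj}_{\mathcal R_1}(\mathcal R_2)=\mathcal R_1$ and $\operatorname{proj}_{\mathcal R_2}(\mathcal R_1)=\mathcal R_2$, where $\operatorname{proj}_{\mathcal R}(c)$ is the unique chamber of $\mathcal R$ closest to $c$. A subset $C\subseteq\Delta$ is panel-closed if it is convex (for all $c,d\in C$, all chambers on all minimal galleries from $c$ to $d$ lie in $C$) and each panel containing at least two chambers of $C$ is completely contained in $C$. *)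

theory Defs
  imports "HOL-Algebra.Group_Action" "HOL-Library.Extended_Nat" "HOL-Library.Equipollence"
begin

text \<open>Right-angled Coxeter matrices and their Coxeter groups\<close>

definition coxeter_matrix :: "'i set \<Rightarrow> ('i \<Rightarrow> 'i \<Rightarrow> enat) \<Rightarrow> bool" where
  "coxeter_matrix I m \<longleftrightarrow>
     (\<forall>i\<in>I. \<forall>j\<in>I. m i j = m j i \<and> m i j \<noteq> 0 \<and> (m i j = 1 \<longleftrightarrow> i = j))"

definition right_angled :: "'i set \<Rightarrow> ('i \<Rightarrow> 'i \<Rightarrow> enat) \<Rightarrow> bool" where
  "right_angled I m \<longleftrightarrow>
     coxeter_matrix I m \<and> (\<forall>i\<in>I. \<forall>j\<in>I. i \<noteq> j \<longrightarrow> m i j \<in> {2, \<infinity>})"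

text \<open>
  Two words over \<open>I\<close> are related iff they represent the same element of the Coxeter group
  presented by the relations \<open>(s\<^sub>i s\<^sub>j)\<^bsup>m i j\<^esup> = 1\<close>.
  The relation \<open>s\<^sub>i s\<^sub>i = 1\<close> (the case \<open>i = j\<close>) makes the monoid
  presentation a group presentation, so words need no formal inverses.
\<close>

inductive_set coxeter_rel :: "'i set \<Rightarrow> ('i \<Rightarrow> 'i \<Rightarrow> enat) \<Rightarrow> ('i list \<times> 'i list) set"
  for I :: "'i set" and m :: "'i \<Rightarrow> 'i \<Rightarrow> enat" where
  relator: "\<lbrakk>u \<in> lists I; v \<in> lists I; i \<in> I; j \<in> I; m i j = enat n\<rbrakk>
     \<Longrightarrow> (u @ concat (replicate n [i, j]) @ v, u @ v) \<in> coxeter_rel I m"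
| refl: "w \<in> lists I \<Longrightarrow> (w, w) \<in> coxeter_rel I m"
| sym: "(v, w) \<in> coxeter_rel I m \<Longrightarrow> (w, v) \<in> coxeter_rel I m"
| trans: "\<lbrakk>(u, v) \<in> coxeter_rel I m; (v, w) \<in> coxeter_rel I m\<rbrakk> \<Longrightarrow> (u, w) \<in> coxeter_rel I m"

lemma equiv_coxeter_rel: "equiv (lists I) (coxeter_rel I m)"
proof (rule equivI)
  have "v \<in> lists I \<and> w \<in> lists I" if "(v, w) \<in> coxeter_rel I m" for v w
    using that by induction (auto split: if_splits)
  then show "coxeter_rel I m \<subseteq> lists I \<times> lists I"
    by (intro subrelI SigmaI) simp_all
  show "refl_on (lists I) (coxeter_rel I m)" by (auto simp: refl_on_def intro: coxeter_rel.refl)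
  show "sym (coxeter_rel I m)" by (auto simp: sym_def intro: coxeter_rel.sym)
  show "trans (coxeter_rel I m)" by (auto simp: trans_def intro: coxeter_rel.trans)
qed

definition coxeter_group :: "'i set \<Rightarrow> ('i \<Rightarrow> 'i \<Rightarrow> enat) \<Rightarrow> 'i list set set" where
  "coxeter_group I m = lists I // coxeter_rel I m"

definition reduced_word :: "'i set \<Rightarrow> ('i \<Rightarrow> 'i \<Rightarrow> enat) \<Rightarrow> 'i list \<Rightarrow> bool" where
  "reduced_word I m w \<longleftrightarrow>
     w \<in> lists I \<and> (\<forall>v. (w, v) \<in> coxeter_rel I m \<longrightarrow> length w \<le> length v)"

text \<open>Chamber systems\<close>

record ('i, 'c) chamber_system =
  typeset :: "'i set"
  chambers :: "'c set"
  adj :: "'i \<Rightarrow> ('c \<times> 'c) set"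

definition is_chamber_system :: "('i, 'c) chamber_system \<Rightarrow> bool" where
  "is_chamber_system X \<longleftrightarrow> chambers X \<noteq> {} \<and> (\<forall>i\<in>typeset X. equiv (chambers X) (adj X i))"

text \<open>
  \<open>gallery X w cs\<close>: the list \<open>cs\<close> of chambers is a gallery of type \<open>w\<close>. As usual for
  galleries with a type, consecutive chambers are required to be distinct.
\<close>

definition gallery :: "('i, 'c) chamber_system \<Rightarrow> 'i list \<Rightarrow> 'c list \<Rightarrow> bool" where
  "gallery X w cs \<longleftrightarrow>
     w \<in> lists (typeset X) \<and> cs \<in> lists (chambers X) \<and> length cs = Suc (length w) \<and>
     (\<forall>k<length w. (cs ! k, cs ! Suc k) \<in> adj X (w ! k) \<and> cs ! k \<noteq> cs ! Suc k)"

definition gallery_between ::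
  "('i, 'c) chamber_system \<Rightarrow> 'i list \<Rightarrow> 'c list \<Rightarrow> 'c \<Rightarrow> 'c \<Rightarrow> bool" where
  "gallery_between X w cs c d \<longleftrightarrow> gallery X w cs \<and> hd cs = c \<and> last cs = d"

definition gallery_dist :: "('i, 'c) chamber_system \<Rightarrow> 'c \<Rightarrow> 'c \<Rightarrow> nat" where
  "gallery_dist X c d = (LEAST n. \<exists>w cs. gallery_between X w cs c d \<and> length w = n)"

definition minimal_gallery ::
  "('i, 'c) chamber_system \<Rightarrow> 'c list \<Rightarrow> 'c \<Rightarrow> 'c \<Rightarrow> bool" where
  "minimal_gallery X cs c d \<longleftrightarrow>
     (\<exists>w. gallery_between X w cs c d \<and> length w = gallery_dist X c d)"

definition is_residue :: "('i, 'c) chamber_system \<Rightarrow> 'i set \<Rightarrow> 'c set \<Rightarrow> bool" where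
  "is_residue X J R \<longleftrightarrow>
     J \<subseteq> typeset X \<and> (\<exists>c\<in>chambers X. R = {d. (c, d) \<in> (\<Union>j\<in>J. adj X j)\<^sup>*})"

definition is_panel :: "('i, 'c) chamber_system \<Rightarrow> 'i \<Rightarrow> 'c set \<Rightarrow> bool" where
  "is_panel X i P \<longleftrightarrow> is_residue X {i} P"

lemma is_panel_iff:
  assumes "is_chamber_system X" and "i \<in> typeset X"
  shows "is_panel X i P \<longleftrightarrow> P \<in> chambers X // adj X i"
proof -
  from assms have e: "equiv (chambers X) (adj X i)" by (simp add: is_chamber_system_def)
  then have "(adj X i)\<^sup>* = (adj X i)\<^sup>="
    by (simp add: equiv_def rtrancl_trancl_reflcl trancl_id)
  then have "{d. (c, d) \<in> (adj X i)\<^sup>*} = adj X i `` {c}" if "c \<in> chambers X" for c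
    using e that by (auto simp: equiv_def refl_on_def)
  then show ?thesis
    using assms(2) by (auto simp: is_panel_def is_residue_def quotient_def)
qed

text \<open>
  Buildings, as chamber systems with a Weyl distance \<open>\<delta>\<close> valued in the Coxeter group. The Weyl
  distance is determined by the chamber system and is therefore not part of the structure.
\<close>

definition weyl_distance ::
  "('i, 'c) chamber_system \<Rightarrow> ('i \<Rightarrow> 'i \<Rightarrow> enat) \<Rightarrow> ('c \<Rightarrow> 'c \<Rightarrow> 'i list set) \<Rightarrow> bool" where
  "weyl_distance X m \<delta> \<longleftrightarrow>
     (\<forall>c\<in>chambers X. \<forall>d\<in>chambers X.
        \<delta> c d \<in> coxeter_group (typeset X) m \<and>
        (\<forall>w. reduced_word (typeset X) m w \<longrightarrow>
           (\<delta> c d = coxeter_rel (typeset X) m `` {w} \<longleftrightarrow> (\<exists>cs. gallery_between X w cs c d))))"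

definition building :: "('i, 'c) chamber_system \<Rightarrow> ('i \<Rightarrow> 'i \<Rightarrow> enat) \<Rightarrow> bool" where
  "building X m \<longleftrightarrow>
     coxeter_matrix (typeset X) m \<and> is_chamber_system X \<and>
     (\<forall>i\<in>typeset X. \<forall>P. is_panel X i P \<longrightarrow> (\<exists>c\<in>P. \<exists>d\<in>P. c \<noteq> d)) \<and>
     (\<exists>\<delta>. weyl_distance X m \<delta>)"

definition right_angled_building ::
  "('i, 'c) chamber_system \<Rightarrow> ('i \<Rightarrow> 'i \<Rightarrow> enat) \<Rightarrow> bool" where
  "right_angled_building X m \<longleftrightarrow> right_angled (typeset X) m \<and> building X m"

text \<open>
  The parameters are cardinals \<open>q i\<close>, possibly infinite, each given by a set \<open>Q i\<close> of that
  cardinality. In a building they are automatically at least 2.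
\<close>

definition semiregular :: "('i, 'c) chamber_system \<Rightarrow> ('i \<Rightarrow> 'a set) \<Rightarrow> bool" where
  "semiregular X Q \<longleftrightarrow> (\<forall>i\<in>typeset X. \<forall>P. is_panel X i P \<longrightarrow> P \<approx> Q i)"

definition Aut :: "('i, 'c) chamber_system \<Rightarrow> ('c \<Rightarrow> 'c) set" where
  "Aut X = {g \<in> Bij (chambers X).
     \<forall>i\<in>typeset X. \<forall>c\<in>chambers X. \<forall>d\<in>chambers X. (g c, g d) \<in> adj X i \<longleftrightarrow> (c, d) \<in> adj X i}"

definition proj :: "('i, 'c) chamber_system \<Rightarrow> 'c set \<Rightarrow> 'c \<Rightarrow> 'c" where
  "proj X R c = (THE d. is_arg_min (gallery_dist X c) (\<lambda>e. e \<in> R) d)"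

definition parallel :: "('i, 'c) chamber_system \<Rightarrow> 'c set \<Rightarrow> 'c set \<Rightarrow> bool" where
  "parallel X R1 R2 \<longleftrightarrow> proj X R1 ` R2 = R1 \<and> proj X R2 ` R1 = R2"

definition convex :: "('i, 'c) chamber_system \<Rightarrow> 'c set \<Rightarrow> bool" where
  "convex X C \<longleftrightarrow> (\<forall>c\<in>C. \<forall>d\<in>C. \<forall>cs. minimal_gallery X cs c d \<longrightarrow> set cs \<subseteq> C)"

definition panel_closed :: "('i, 'c) chamber_system \<Rightarrow> 'c set \<Rightarrow> bool" where
  "panel_closed X C \<longleftrightarrow>
     C \<subseteq> chambers X \<and> convex X C \<and>
     (\<forall>i\<in>typeset X. \<forall>P. is_panel X i P \<longrightarrow>
        (\<exists>c\<in>P \<inter> C. \<exists>d\<in>P \<inter> C. c \<noteq> d) \<longrightarrow> P \<subseteq> C)"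

text \<open>Colorings, local actions and local data\<close>

definition legal_coloring ::
  "('i, 'c) chamber_system \<Rightarrow> ('i \<Rightarrow> 'a set) \<Rightarrow> ('i \<Rightarrow> 'c \<Rightarrow> 'a) \<Rightarrow> bool" where
  "legal_coloring X \<Omega> lam \<longleftrightarrow>
     (\<forall>i\<in>typeset X. lam i \<in> chambers X \<rightarrow> \<Omega> i) \<and>
     (\<forall>i\<in>typeset X. \<forall>P. is_panel X i P \<longrightarrow>
        bij_betw (lam i) P (\<Omega> i) \<and>
        (\<forall>j\<in>typeset X. j \<noteq> i \<longrightarrow> (\<forall>c\<in>P. \<forall>d\<in>P. lam j c = lam j d)))"

text \<open>
  The restriction to \<open>\<Omega> i\<close> makes the local action an element of \<open>BijGroup (\<Omega> i)\<close>, the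
  symmetric group on \<open>\<Omega> i\<close>, whose elements are extensional functions.
\<close>

definition local_action ::
  "('i \<Rightarrow> 'a set) \<Rightarrow> ('i \<Rightarrow> 'c \<Rightarrow> 'a) \<Rightarrow> ('c \<Rightarrow> 'c) \<Rightarrow> 'i \<Rightarrow> 'c set \<Rightarrow> 'a \<Rightarrow> 'a" where
  "local_action \<Omega> lam g i P = restrict (lam i \<circ> g \<circ> inv_into P (lam i)) (\<Omega> i)"

definition local_data :: "'i set \<Rightarrow> ('i \<Rightarrow> 'a set) \<Rightarrow> ('i \<Rightarrow> ('a \<Rightarrow> 'a) set) \<Rightarrow> bool" where
  "local_data I \<Omega> F \<longleftrightarrow> (\<forall>i\<in>I. subgroup (F i) (BijGroup (\<Omega> i)))"

definition harmonious ::
  "'i set \<Rightarrow> ('i \<Rightarrow> 'a set) \<Rightarrow> ('i \<Rightarrow> 'c \<Rightarrow> 'a) \<Rightarrow> ('i \<Rightarrow> ('a \<Rightarrow> 'a) set) \<Rightarrow> 'c \<Rightarrow> 'c \<Rightarrow> bool" where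
  "harmonious I \<Omega> lam F c c' \<longleftrightarrow>
     (\<forall>k\<in>I. \<exists>orb \<in> orbits (BijGroup (\<Omega> k)\<lparr>carrier := F k\<rparr>) (\<Omega> k) (\<lambda>f. f).
        lam k c \<in> orb \<and> lam k c' \<in> orb)"

end

theory Submission
  imports Defs
begin

text \<open>
  Let \<open>\<ell>(x)\<close> be the gallery distance of a chamber \<open>x\<close> to \<open>C\<close>. Since \<open>C\<close> is panel-closed, chambers
  have gates in \<open>C\<close>, so on each panel \<open>P\<close> either \<open>\<ell>\<close> is constant, and then \<open>P\<close> is parallel to a
  panel of \<open>C\<close>, or \<open>\<ell>\<close> has a unique minimum. Starting from \<open>h = g\<close> on \<open>C\<close>, extend \<open>h\<close> by
  recursion on \<open>\<ell>\<close>: on an \<open>i\<close>-panel with a unique minimum \<open>p\<close>, let \<open>h\<close> act on the colors by a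
  permutation in \<open>F\<^sub>i\<close> chosen in terms of \<open>i\<close>, \<open>\<lambda>\<^sub>i(p)\<close> and \<open>\<lambda>\<^sub>i(h(p))\<close> only. If a chamber can be
  reached in this way through two panels, of types \<open>i \<noteq> j\<close>, then \<open>i\<close> and \<open>j\<close> commute and the
  chamber lies opposite to a chamber two levels below; as an \<open>i\<close>-step does not change \<open>\<lambda>\<^sub>j\<close>, both
  choices lead to the same value. The resulting map sends each panel bijectively onto a panel,
  hence it maps galleries of reduced type to galleries of the same type and is an automorphism.
\<close>

section \<open>Words up to commutation\<close>

locale commutation =
  fixes comm :: "'i \<Rightarrow> 'i \<Rightarrow> bool"
  assumes comm_sym: "comm i j \<Longrightarrow> comm j i"
    and comm_irrefl: "\<not> comm i i"
begin

text \<open>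
  Words that differ by swaps of adjacent commuting letters. Comparing the projections to all
  non-commuting pairs of letters (including \<open>i = j\<close>) makes cancellation immediate.
\<close>

definition eqv :: "'i list \<Rightarrow> 'i list \<Rightarrow> bool" where
  "eqv v w \<longleftrightarrow>
     (\<forall>i j. \<not> comm i j \<longrightarrow> filter (\<lambda>k. k = i \<or> k = j) v = filter (\<lambda>k. k = i \<or> k = j) w)"

lemma eqv_refl [simp]: "eqv w w"
  by (simp add: eqv_def)

lemma eqv_sym: "eqv v w \<Longrightarrow> eqv w v"
  by (simp add: eqv_def)

lemma eqv_trans [trans]: "eqv u v \<Longrightarrow> eqv v w \<Longrightarrow> eqv u w"
  by (simp add: eqv_def)

lemma eqv_Cons_iff [simp]: "eqv (i # v) (i # w) \<longleftrightarrow> eqv v w"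
  by (auto simp: eqv_def)

lemma eqv_rev: "eqv v w \<Longrightarrow> eqv (rev v) (rev w)"
  by (simp add: eqv_def rev_filter[symmetric])

lemma eqv_swap: "comm i j \<Longrightarrow> eqv (i # j # w) (j # i # w)"
  using comm_sym by (auto simp: eqv_def)

lemma eqv_set:
  assumes "eqv v w" shows "set v = set w"
proof (rule Set.set_eqI)
  fix i
  have "filter (\<lambda>k. k = i \<or> k = i) v = filter (\<lambda>k. k = i \<or> k = i) w"
    using assms comm_irrefl unfolding eqv_def by blast
  from arg_cong[OF this, of set] show "i \<in> set v \<longleftrightarrow> i \<in> set w" by auto
qed

text \<open>Holds when the first \<open>i\<close> in the word can be swapped to the front: every
  letter before it commutes with \<open>i\<close>.\<close>

fun initial :: "'i \<Rightarrow> 'i list \<Rightarrow> bool" where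
  "initial i [] \<longleftrightarrow> False"
| "initial i (j # w) \<longleftrightarrow> i = j \<or> comm i j \<and> initial i w"

lemma initial_in_set: "initial i w \<Longrightarrow> i \<in> set w"
  by (induction w) auto

lemma initial_append:
  "initial i (u @ v) \<longleftrightarrow> initial i u \<or> (\<forall>j\<in>set u. comm i j) \<and> initial i v"
  by (induction u) auto

lemma eqv_remove1: "initial i w \<Longrightarrow> eqv w (i # remove1 i w)"
proof (induction w)
  case (Cons j w)
  then show ?case
    using eqv_trans[of "j # w" "j # i # remove1 i w"] eqv_swap comm_sym by auto
qed simp

text \<open>Testing with \<open>j\<close> the front letter shows that this letter is
  \<open>i\<close> or commutes with \<open>i\<close>. In the latter case it occurs in none of the
  projections considered, so the induction hypothesis applies to the tail.\<close>

lemma initialI: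
  "(\<And>j. \<not> comm i j \<Longrightarrow> \<exists>t. filter (\<lambda>k. k = i \<or> k = j) w = i # t) \<Longrightarrow> initial i w"
proof (induction w)
  case Nil
  then show ?case using comm_irrefl by auto
next
  case (Cons l w)
  show ?case
  proof (cases "i = l \<or> \<not> comm i l")
    case True
    then show ?thesis using Cons.prems[of l] by auto
  next
    case False
    have "\<exists>t. filter (\<lambda>k. k = i \<or> k = j) w = i # t" if "\<not> comm i j" for j
      using Cons.prems[OF that] that False by (auto split: if_splits)
    then show ?thesis using Cons.IH False by simp
  qed
qed

lemma eqv_ConsD:
  assumes "eqv (i # u) w" shows "initial i w" "eqv u (remove1 i w)"
proof -
  show "initial i w"
  proof (rule initialI)
    fix j assume "\<not> comm i j"
    then have "filter (\<lambda>k. k = i \<or> k = j) w = filter (\<lambda>k. k = i \<or> k = j) (i # u)"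
      using assms unfolding eqv_def by metis
    then show "\<exists>t. filter (\<lambda>k. k = i \<or> k = j) w = i # t" by simp
  qed
  from eqv_remove1[OF this] assms have "eqv (i # u) (i # remove1 i w)"
    using eqv_trans by blast
  then show "eqv u (remove1 i w)" by simp
qed

lemma eqv_length: "eqv v w \<Longrightarrow> length v = length w"
proof (induction v arbitrary: w)
  case Nil
  then show ?case using eqv_set by force
next
  case (Cons i v)
  note e = eqv_ConsD[OF Cons.prems]
  from initial_in_set[OF e(1)] Cons.IH[OF e(2)] show ?case
    by (simp add: length_remove1) (metis Suc_pred length_pos_if_in_set)
qed

lemma initial_eqv: "eqv v w \<Longrightarrow> initial i v \<Longrightarrow> initial i w"
  using eqv_ConsD(1) eqv_remove1 eqv_sym eqv_trans by blast

lemma eqv_Cons_snoc: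
  "(\<And>j. j \<in> set w \<Longrightarrow> comm i j) \<Longrightarrow> eqv (i # w) (w @ [i])"
proof (induction w)
  case (Cons j w)
  then have "eqv (i # j # w) (j # i # w)" "eqv (i # w) (w @ [i])" by (auto intro: eqv_swap)
  then show ?case using eqv_trans[of "i # j # w" "j # i # w"] by simp
qed simp

section \<open>Reduced words and cancellation\<close>

definition red :: "'i list \<Rightarrow> bool" where
  "red w \<longleftrightarrow> \<not> (\<exists>u i v. eqv w (u @ i # i # v))"

lemma red_Nil [simp]: "red []"
  by (auto simp: red_def dest: eqv_length)

lemma red_eqv: "eqv v w \<Longrightarrow> red v \<Longrightarrow> red w"
  unfolding red_def using eqv_trans by blast

text \<open>For the converse, locate the leading \<open>i\<close> in a word
  \<open>u @ k # k # v\<close> equivalent to \<open>i # w\<close>. If it lies in \<open>u\<close> or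
  \<open>v\<close>, deleting it keeps the double letter; if it is one of the two \<open>k\<close>,
  the other one is initial in \<open>w\<close>.\<close>

lemma red_Cons_iff: "red (i # w) \<longleftrightarrow> red w \<and> \<not> initial i w"
proof (intro iffI conjI notI)
  assume r: "red (i # w)"
  show "red w"
    unfolding red_def
  proof clarify
    fix u k v assume "eqv w (u @ k # k # v)"
    then have "eqv (i # w) ((i # u) @ k # k # v)" by simp
    with r show False unfolding red_def by blast
  qed
  assume "initial i w"
  then have "eqv (i # w) ([] @ i # i # remove1 i w)" by (simp add: eqv_remove1)
  with r show False unfolding red_def by blast
next
  assume r: "red w \<and> \<not> initial i w"
  show "red (i # w)"
    unfolding red_def
  proof clarify
    fix u k v assume "eqv (i # w) (u @ k # k # v)"
    note e = eqv_ConsD[OF this]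
    from e(1) consider "initial i u"
      | "\<forall>j\<in>set u. comm i j" "i = k"
      | "\<forall>j\<in>set u. comm i j" "i \<noteq> k" "comm i k" "initial i v"
      by (auto simp: initial_append)
    then show False
    proof cases
      case 1
      then have "eqv w (remove1 i u @ k # k # v)"
        using e(2) initial_in_set by (simp add: remove1_append)
      then show False using r unfolding red_def by blast
    next
      case 2
      then have "i \<notin> set u" using comm_irrefl by auto
      then have "eqv w (u @ k # v)" using e(2) 2 by (simp add: remove1_append)
      moreover have "initial i (u @ k # v)" using 2 by (simp add: initial_append)
      ultimately show False using r initial_eqv eqv_sym by blast
    next
      case 3
      then have "i \<notin> set u" using comm_irrefl by auto
      then have "eqv w (u @ k # k # remove1 i v)" using e(2) 3 by (simp add: remove1_append)
      then show False using r unfolding red_def by blast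
    qed
  qed
qed

lemma red_rev: "red w \<Longrightarrow> red (rev w)"
  unfolding red_def
proof clarify
  fix u i v assume *: "\<nexists>u i v. eqv w (u @ i # i # v)" and "eqv (rev w) (u @ i # i # v)"
  from eqv_rev[OF this(2)] have "eqv w (rev v @ i # i # rev u)" by simp
  with * show False by blast
qed

text \<open>Strip letters off the front of \<open>u\<close> until the remaining concatenation is
  reduced. The last letter stripped is then initial in \<open>v\<close> and commutes with the rest
  of \<open>u\<close>, so it can be moved to the end of \<open>u\<close>.\<close>

lemma not_red_appendE:
  assumes "red u" "red v" "\<not> red (u @ v)"
  obtains k u' v' where "eqv u (u' @ [k])" "eqv v (k # v')"
  using assms(1,3)
proof (induction u arbitrary: thesis)
  case Nil
  then show ?case using assms by simp
next
  case (Cons i u)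
  show ?case
  proof (cases "red (u @ v)")
    case True
    then have "initial i (u @ v)" using Cons.prems(3) by (simp add: red_Cons_iff)
    moreover have "\<not> initial i u" using Cons.prems(2) by (simp add: red_Cons_iff)
    ultimately have "\<forall>j\<in>set u. comm i j" "initial i v" by (auto simp: initial_append)
    then show ?thesis using Cons.prems(1) eqv_Cons_snoc eqv_remove1 by blast
  next
    case False
    then obtain k u' v' where "eqv u (u' @ [k])" "eqv v (k # v')"
      using Cons.IH Cons.prems(2) by (auto simp: red_Cons_iff)
    then show ?thesis using Cons.prems(1)[of "i # u'" k v'] by simp
  qed
qed

text \<open>The leading \<open>i\<close> is initial in \<open>u @ [k]\<close>. If it is found in
  \<open>u\<close>, deleting it leaves \<open>k\<close> at the end of \<open>w\<close>; otherwise it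
  is \<open>k\<close> itself, and \<open>u\<close>, equivalent to \<open>w\<close>, commutes with
  it.\<close>

lemma eqv_Cons_snocE:
  assumes "eqv (i # w) (u @ [k])"
  obtains w' where "eqv w (w' @ [k])" | "k = i" "\<And>j. j \<in> set w \<Longrightarrow> comm i j"
proof -
  note e = eqv_ConsD[OF assms]
  from e(1) consider "initial i u" | "\<not> initial i u" "\<forall>j\<in>set u. comm i j" "i = k"
    by (auto simp: initial_append)
  then show ?thesis
  proof cases
    case 1
    then have "eqv w (remove1 i u @ [k])" using e(2) initial_in_set by (simp add: remove1_append)
    then show ?thesis by (rule that(1))
  next
    case 2
    then have "i \<notin> set u" using comm_irrefl by auto
    then have "eqv w u" using e(2) 2 by (simp add: remove1_append)
    then show ?thesis using that(2) 2 eqv_set by blast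
  qed
qed

section \<open>Generators acting on reduced words\<close>

text \<open>Left multiplication by the generator \<open>i\<close>, expressed on reduced
  representatives.\<close>

definition ins :: "'i \<Rightarrow> 'i list \<Rightarrow> 'i list" where
  "ins i w = (if initial i w then remove1 i w else i # w)"

lemma ins_eqv:
  assumes "eqv v w" shows "eqv (ins i v) (ins i w)"
proof (cases "initial i v")
  case True
  then have "eqv (i # remove1 i v) w"
    using assms eqv_remove1 eqv_sym eqv_trans by blast
  from eqv_ConsD[OF this] True show ?thesis by (simp add: ins_def)
next
  case False
  then have "\<not> initial i w" using assms initial_eqv eqv_sym by blast
  with False assms show ?thesis by (simp add: ins_def)
qed

lemma red_ins: "red w \<Longrightarrow> red (ins i w)"
  using red_eqv[OF eqv_remove1] by (auto simp: ins_def red_Cons_iff)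

lemma ins_ins:
  assumes "red w" shows "eqv (ins i (ins i w)) w"
proof (cases "initial i w")
  case True
  note e = eqv_remove1[OF True]
  from red_eqv[OF e assms] have "\<not> initial i (remove1 i w)" by (simp add: red_Cons_iff)
  then show ?thesis using True e eqv_sym by (simp add: ins_def)
qed (simp add: ins_def)

lemma ins_commute:
  assumes c: "comm i j" shows "eqv (ins i (ins j w)) (ins j (ins i w))"
proof -
  have ij: "i \<noteq> j" "j \<noteq> i" "comm j i" using c comm_irrefl comm_sym by auto
  \<comment> \<open>Since \<open>ins\<close> respects \<open>eqv\<close>, the word \<open>w\<close>
    may be replaced by one that displays its initial letter in front.\<close>
  have rep: ?thesis
    if "eqv w v" "eqv (ins i (ins j v)) (ins j (ins i v))" for v
    using that ins_eqv eqv_sym eqv_trans by meson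
  show ?thesis
  proof (cases "initial i w")
    case True
    show ?thesis
    proof (rule rep)
      show "eqv w (i # remove1 i w)" using True by (rule eqv_remove1)
      show "eqv (ins i (ins j (i # remove1 i w))) (ins j (ins i (i # remove1 i w)))"
        using ij c by (simp add: ins_def)
    qed
  next
    case i: False
    show ?thesis
    proof (cases "initial j w")
      case True
      show ?thesis
      proof (rule rep)
        show "eqv w (j # remove1 j w)" using True by (rule eqv_remove1)
        show "eqv (ins i (ins j (j # remove1 j w))) (ins j (ins i (j # remove1 j w)))"
          using ij c by (simp add: ins_def)
      qed
    next
      case False
      with i ij c show ?thesis by (simp add: ins_def eqv_swap)
    qed
  qed
qed

lemma red_foldr_ins: "red x \<Longrightarrow> red (foldr ins w x)"
  by (induction w) (auto intro: red_ins)

lemma eqv_foldr_ins: "eqv x y \<Longrightarrow> eqv (foldr ins w x) (foldr ins w y)"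
  by (induction w) (auto intro: ins_eqv)

lemma foldr_ins_red: "red w \<Longrightarrow> foldr ins w [] = w"
  by (induction w) (auto simp: red_Cons_iff ins_def)

end

section \<open>The word problem in right-angled Coxeter groups\<close>

locale right_angled_coxeter =
  fixes I :: "'i set" and m :: "'i \<Rightarrow> 'i \<Rightarrow> enat"
  assumes ra: "right_angled I m"
begin

definition comm :: "'i \<Rightarrow> 'i \<Rightarrow> bool" where
  "comm i j \<longleftrightarrow> i \<in> I \<and> j \<in> I \<and> i \<noteq> j \<and> m i j = 2"

sublocale commutation comm
  using ra by unfold_locales (auto simp: comm_def right_angled_def coxeter_matrix_def)

lemma m_self: "i \<in> I \<Longrightarrow> m i i = 1"
  using ra by (simp add: right_angled_def coxeter_matrix_def)

lemma m_distinct: "i \<in> I \<Longrightarrow> j \<in> I \<Longrightarrow> i \<noteq> j \<Longrightarrow> m i j = 2 \<or> m i j = \<infinity>"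
  using ra by (simp add: right_angled_def)

lemma coxeter_rel_in_lists: "(v, w) \<in> coxeter_rel I m \<Longrightarrow> v \<in> lists I \<and> w \<in> lists I"
  using equiv_coxeter_rel[of I m] unfolding equiv_def by blast

text \<open>
  Words act on commutation classes of reduced words through \<open>ins\<close>, and the relators of the
  Coxeter group act trivially.
\<close>

lemma coxeter_rel_foldr_ins:
  assumes "(v, w) \<in> coxeter_rel I m" and "red x"
  shows "eqv (foldr ins v x) (foldr ins w x)"
  using assms
proof (induction arbitrary: x)
  case (relator u v i j n)
  let ?y = "foldr ins v x"
  have y: "red ?y" using relator red_foldr_ins by blast
  have "eqv (foldr ins (concat (replicate n [i, j])) ?y) ?y"
  proof (cases "i = j")
    case True
    then have "enat n = 1"
      using relator.hyps(3,5) m_self by metis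
    then have "n = 1" by (simp add: one_enat_def)
    then show ?thesis using True y by (simp add: ins_ins)
  next
    case False
    then have "m i j = 2" using relator.hyps(3,4,5) m_distinct by fastforce
    then have c: "comm i j" and "enat n = 2"
      using relator.hyps(3,4,5) False by (simp_all add: comm_def)
    then have "n = 2" by (metis enat.inject numeral_eq_enat)
    then have "foldr ins (concat (replicate n [i, j])) ?y = ins i (ins j (ins i (ins j ?y)))"
      by (simp add: numeral_2_eq_2)
    also have "eqv \<dots> (ins i (ins i (ins j (ins j ?y))))"
      using c comm_sym by (intro ins_eqv ins_commute) auto
    also have "eqv \<dots> (ins j (ins j ?y))" using y by (intro ins_ins red_ins)
    also have "eqv \<dots> ?y" using y by (rule ins_ins)
    finally show ?thesis .
  qed
  then show ?case by (simp add: eqv_foldr_ins)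
next
  case (sym v w)
  then show ?case using eqv_sym by blast
next
  case (trans u v w)
  then show ?case using eqv_trans by blast
qed simp

text \<open>Let both words act on the empty word, where a reduced word reproduces itself.\<close>

lemma coxeter_rel_eqv:
  "(v, w) \<in> coxeter_rel I m \<Longrightarrow> red v \<Longrightarrow> red w \<Longrightarrow> eqv v w"
  using coxeter_rel_foldr_ins[of v w "[]"] by (simp add: foldr_ins_red)

section \<open>Swaps and cancellations as consequences of the relators\<close>

lemma coxeter_rel_cancel:
  assumes "u \<in> lists I" "v \<in> lists I" "i \<in> I"
  shows "(u @ i # i # v, u @ v) \<in> coxeter_rel I m"
proof -
  have "m i i = enat 1"
    using m_self[OF assms(3)] by (simp add: one_enat_def)
  from coxeter_rel.relator[of u I v i i m 1, OF assms(1,2,3,3) this] show ?thesis by simp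
qed

text \<open>Insert the relator \<open>[i, j, i, j]\<close> after \<open>[j, i]\<close>; cancelling
  the double \<open>i\<close> and then the double \<open>j\<close> leaves
  \<open>[i, j]\<close>.\<close>

lemma coxeter_rel_swap:
  assumes "u \<in> lists I" "v \<in> lists I" "comm i j"
  shows "(u @ i # j # v, u @ j # i # v) \<in> coxeter_rel I m"
proof -
  have ij: "i \<in> I" "j \<in> I" "m i j = enat 2"
    using assms by (auto simp: comm_def numeral_eq_enat)
  have "(u @ [j, i] @ [i, j, i, j] @ v, u @ [j, i] @ v) \<in> coxeter_rel I m"
    using coxeter_rel.relator[of "u @ [j, i]" I v i j m 2] ij assms by (simp add: numeral_2_eq_2)
  moreover have "(u @ [j, i] @ [i, j, i, j] @ v, u @ [j, j, i, j] @ v) \<in> coxeter_rel I m"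
    using coxeter_rel_cancel[of "u @ [j]" "[j, i, j] @ v" i] ij assms by simp
  moreover have "(u @ [j, j, i, j] @ v, u @ [i, j] @ v) \<in> coxeter_rel I m"
    using coxeter_rel_cancel[of u "[i, j] @ v" j] ij assms by simp
  ultimately have "(u @ [i, j] @ v, u @ [j, i] @ v) \<in> coxeter_rel I m"
    using coxeter_rel.sym coxeter_rel.trans by meson
  then show ?thesis by simp
qed

lemma coxeter_rel_initial:
  "u \<in> lists I \<Longrightarrow> w \<in> lists I \<Longrightarrow> initial i w \<Longrightarrow> (u @ w, u @ i # remove1 i w) \<in> coxeter_rel I m"
proof (induction w arbitrary: u)
  case (Cons j w)
  show ?case
  proof (cases "i = j")
    case True
    then show ?thesis using Cons.prems by (simp add: coxeter_rel.refl)
  next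
    case False
    then have c: "comm j i" "initial i w" using Cons.prems comm_sym by auto
    have "(u @ j # w, u @ j # i # remove1 i w) \<in> coxeter_rel I m"
      using Cons.IH[of "u @ [j]"] c Cons.prems by simp
    moreover have "remove1 i w \<in> lists I"
      using Cons.prems by (auto dest: notin_set_remove1)
    then have "(u @ j # i # remove1 i w, u @ i # j # remove1 i w) \<in> coxeter_rel I m"
      using c Cons.prems by (intro coxeter_rel_swap) auto
    ultimately show ?thesis using False coxeter_rel.trans by auto
  qed
qed simp

lemma eqv_coxeter_rel:
  "eqv v w \<Longrightarrow> u \<in> lists I \<Longrightarrow> w \<in> lists I \<Longrightarrow> (u @ v, u @ w) \<in> coxeter_rel I m"
proof (induction v arbitrary: u w)
  case Nil
  then have "w = []" using eqv_length by force
  then show ?case using Nil by (simp add: coxeter_rel.refl)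
next
  case (Cons i v)
  note [trans] = coxeter_rel.trans
  note e = eqv_ConsD[OF Cons.prems(1)]
  have i: "i \<in> I" using e(1) initial_in_set Cons.prems by auto
  have "remove1 i w \<in> lists I" using Cons.prems by (auto dest: notin_set_remove1)
  then have "(u @ i # v, u @ i # remove1 i w) \<in> coxeter_rel I m"
    using Cons.IH[OF e(2), of "u @ [i]"] Cons.prems i by simp
  also have "(u @ i # remove1 i w, u @ w) \<in> coxeter_rel I m"
    using coxeter_rel_initial[OF _ _ e(1)] Cons.prems coxeter_rel.sym by blast
  finally show ?case .
qed

lemma reduced_word_red:
  assumes "reduced_word I m w" shows "red w"
  unfolding red_def
proof clarify
  fix u i v assume e: "eqv w (u @ i # i # v)"
  note [trans] = coxeter_rel.trans
  have l: "u @ i # i # v \<in> lists I"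
    using assms eqv_set[OF e] by (auto simp: reduced_word_def)
  have "(w, u @ i # i # v) \<in> coxeter_rel I m" using eqv_coxeter_rel[OF e, of "[]"] l by simp
  also have "(u @ i # i # v, u @ v) \<in> coxeter_rel I m"
    using l by (intro coxeter_rel_cancel) auto
  finally show False
    using assms eqv_length[OF e] by (force simp: reduced_word_def)
qed

lemma ex_reduced_word:
  assumes "v \<in> lists I"
  obtains w where "(v, w) \<in> coxeter_rel I m" "reduced_word I m w"
proof -
  define w where "w = (ARG_MIN length w. (v, w) \<in> coxeter_rel I m)"
  have w: "(v, w) \<in> coxeter_rel I m"
    unfolding w_def by (rule arg_min_natI, rule coxeter_rel.refl[OF assms])
  moreover have "length w \<le> length u" if "(w, u) \<in> coxeter_rel I m" for u
    unfolding w_def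
    using that w coxeter_rel.trans by (intro arg_min_nat_le) (fastforce simp: w_def)
  ultimately show ?thesis using that coxeter_rel_in_lists unfolding reduced_word_def by blast
qed

text \<open>A shortest representative \<open>v\<close> satisfies \<open>red\<close> as well, so it
  differs from \<open>w\<close> by swaps only, and swaps preserve the length.\<close>

lemma red_reduced_word:
  assumes "red w" "w \<in> lists I" shows "reduced_word I m w"
proof -
  obtain v where v: "(w, v) \<in> coxeter_rel I m" "reduced_word I m v"
    using ex_reduced_word assms by blast
  then have "length w = length v"
    using coxeter_rel_eqv[OF v(1)] assms reduced_word_red eqv_length by blast
  then show ?thesis
    using v assms unfolding reduced_word_def by (metis coxeter_rel.sym coxeter_rel.trans)
qed

end

section \<open>Paths in right-angled buildings\<close>

locale ra_building =
  fixes X :: "('i, 'c) chamber_system" and m :: "'i \<Rightarrow> 'i \<Rightarrow> enat"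
  assumes rab: "right_angled_building X m"
begin

sublocale right_angled_coxeter "typeset X" m
  using rab by unfold_locales (simp add: right_angled_building_def)

abbreviation "gdist \<equiv> gallery_dist X"

lemma equiv_adj: "i \<in> typeset X \<Longrightarrow> equiv (chambers X) (adj X i)"
  using rab by (simp add: right_angled_building_def building_def is_chamber_system_def)

lemma adj_chambers:
  assumes "(c, d) \<in> adj X i" "i \<in> typeset X" shows "c \<in> chambers X" "d \<in> chambers X"
  using equiv_adj[OF assms(2)] assms(1) unfolding equiv_def by auto

lemma adj_refl: "i \<in> typeset X \<Longrightarrow> c \<in> chambers X \<Longrightarrow> (c, c) \<in> adj X i"
  using equiv_adj[of i] by (auto simp: equiv_def refl_on_def)

lemma adj_sym: "(c, d) \<in> adj X i \<Longrightarrow> i \<in> typeset X \<Longrightarrow> (d, c) \<in> adj X i"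
  using equiv_adj[of i] by (auto simp: equiv_def dest: symD)

lemma adj_trans:
  "(c, d) \<in> adj X i \<Longrightarrow> (d, e) \<in> adj X i \<Longrightarrow> i \<in> typeset X \<Longrightarrow> (c, e) \<in> adj X i"
  using equiv_adj[of i] by (auto simp: equiv_def dest: transD)

definition panel :: "'i \<Rightarrow> 'c \<Rightarrow> 'c set" where
  "panel i c = adj X i `` {c}"

lemma mem_panel [simp]: "d \<in> panel i c \<longleftrightarrow> (c, d) \<in> adj X i"
  by (simp add: panel_def)

lemma panel_eq: "(c, d) \<in> adj X i \<Longrightarrow> i \<in> typeset X \<Longrightarrow> panel i c = panel i d"
  unfolding panel_def by (rule equiv_class_eq[OF equiv_adj])

lemma is_panel_iff_panel:
  "i \<in> typeset X \<Longrightarrow> is_panel X i P \<longleftrightarrow> (\<exists>c\<in>chambers X. P = panel i c)"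
  using rab is_panel_iff[of X i P]
  by (auto simp: right_angled_building_def building_def quotient_def panel_def)

lemma is_panel_panel: "i \<in> typeset X \<Longrightarrow> c \<in> chambers X \<Longrightarrow> is_panel X i (panel i c)"
  using is_panel_iff_panel by blast

lemma ex_adj_neq:
  assumes "i \<in> typeset X" "c \<in> chambers X"
  obtains d where "(c, d) \<in> adj X i" "d \<noteq> c"
proof -
  have "\<forall>i\<in>typeset X. \<forall>P. is_panel X i P \<longrightarrow> (\<exists>d\<in>P. \<exists>e\<in>P. d \<noteq> e)"
    using rab unfolding right_angled_building_def building_def by blast
  then obtain d e where "(c, d) \<in> adj X i" "(c, e) \<in> adj X i" "d \<noteq> e"
    using is_panel_panel[OF assms] assms(1) by force
  then show ?thesis using that by metis
qed

text \<open>Existence of a gallery of given type, without its list of chambers, in a form suited to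
  induction on the type; \<open>path_gallery\<close> gives the link.\<close>

fun path :: "'i list \<Rightarrow> 'c \<Rightarrow> 'c \<Rightarrow> bool" where
  "path [] c d \<longleftrightarrow> c = d \<and> c \<in> chambers X"
| "path (i # w) c d \<longleftrightarrow> i \<in> typeset X \<and> (\<exists>e. (c, e) \<in> adj X i \<and> c \<noteq> e \<and> path w e d)"

lemma path_chambers: "path w c d \<Longrightarrow> c \<in> chambers X \<and> d \<in> chambers X"
  by (induction w arbitrary: c) (auto dest: adj_chambers)

lemma path_set: "path w c d \<Longrightarrow> set w \<subseteq> typeset X"
  by (induction w arbitrary: c) auto

lemma path_append: "path (u @ v) c d \<longleftrightarrow> (\<exists>e. path u c e \<and> path v e d)"
  by (induction u arbitrary: c) (auto dest: path_chambers)

lemma path_single: "path [i] c d \<longleftrightarrow> i \<in> typeset X \<and> (c, d) \<in> adj X i \<and> c \<noteq> d"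
  using adj_chambers by auto

lemma path_rev: "path w c d \<Longrightarrow> path (rev w) d c"
proof (induction w arbitrary: c)
  case (Cons i w)
  then obtain e where e: "i \<in> typeset X" "(c, e) \<in> adj X i" "c \<noteq> e" "path w e d" by auto
  then have "path [i] e c" unfolding path_single using adj_sym by auto
  with Cons.IH[OF e(4)] show ?case using path_append by auto
qed simp

lemma gallery_ConsI:
  assumes "gallery X w cs" "i \<in> typeset X" "(c, hd cs) \<in> adj X i" "c \<noteq> hd cs"
  shows "gallery X (i # w) (c # cs)"
proof -
  have "hd cs = cs ! 0" using assms(1) by (cases cs) (auto simp: gallery_def)
  moreover have "c \<in> chambers X" using adj_chambers assms by blast
  ultimately show ?thesis
    using assms by (auto simp: gallery_def nth_Cons less_Suc_eq_0_disj split: nat.split)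
qed

lemma gallery_ConsD:
  assumes "gallery X (i # w) cs"
  obtains c cs' where "cs = c # cs'" "i \<in> typeset X" "(c, hd cs') \<in> adj X i" "c \<noteq> hd cs'"
    "gallery X w cs'"
proof -
  obtain c cs' where cs: "cs = c # cs'" using assms by (cases cs) (auto simp: gallery_def)
  have len: "length cs' = Suc (length w)" using assms cs by (simp add: gallery_def)
  then have hd: "hd cs' = cs' ! 0" by (cases cs') auto
  have *: "(cs ! k, cs ! Suc k) \<in> adj X ((i # w) ! k) \<and> cs ! k \<noteq> cs ! Suc k"
    if "k < Suc (length w)" for k
    using assms that by (simp add: gallery_def)
  have "(cs' ! k, cs' ! Suc k) \<in> adj X (w ! k) \<and> cs' ! k \<noteq> cs' ! Suc k" if "k < length w" for k
    using *[of "Suc k"] that cs by simp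
  then have "gallery X w cs'" using assms cs by (simp add: gallery_def)
  moreover have "(c, hd cs') \<in> adj X i" "c \<noteq> hd cs'" using *[of 0] cs hd by simp_all
  moreover have "i \<in> typeset X" using assms by (simp add: gallery_def)
  ultimately show ?thesis using that cs by blast
qed

lemma path_gallery: "path w c d \<longleftrightarrow> (\<exists>cs. gallery_between X w cs c d)"
proof
  show "path w c d \<Longrightarrow> \<exists>cs. gallery_between X w cs c d"
  proof (induction w arbitrary: c)
    case Nil
    then show ?case by (intro exI[of _ "[c]"]) (auto simp: gallery_between_def gallery_def)
  next
    case (Cons i w)
    then obtain e cs where *: "i \<in> typeset X" "(c, e) \<in> adj X i" "c \<noteq> e"
      "gallery_between X w cs e d" by fastforce
    then have "cs \<noteq> []" by (auto simp: gallery_between_def gallery_def)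
    with * have "gallery_between X (i # w) (c # cs) c d"
      by (auto simp: gallery_between_def intro: gallery_ConsI)
    then show ?case by blast
  qed
  assume "\<exists>cs. gallery_between X w cs c d"
  then obtain cs where "gallery_between X w cs c d" ..
  then show "path w c d"
  proof (induction w arbitrary: c cs)
    case Nil
    then obtain x where "cs = [x]" by (auto simp: gallery_between_def gallery_def length_Suc_conv)
    with Nil show ?case by (auto simp: gallery_between_def gallery_def)
  next
    case (Cons i w)
    then obtain c' cs' where *: "cs = c' # cs'" "i \<in> typeset X" "(c', hd cs') \<in> adj X i"
      "c' \<noteq> hd cs'" "gallery X w cs'"
      unfolding gallery_between_def by (blast elim: gallery_ConsD)
    then have "cs' \<noteq> []" by (auto simp: gallery_def)
    with * Cons.prems have "gallery_between X w cs' (hd cs') d" "c = c'"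
      by (auto simp: gallery_between_def)
    with Cons.IH * show ?case by auto
  qed
qed

section \<open>Weyl distance, reduced paths and gallery distance\<close>

lemma weyl:
  obtains \<delta> where "weyl_distance X m \<delta>"
  using rab by (auto simp: right_angled_building_def building_def)

lemma ex_red_path:
  assumes "c \<in> chambers X" "d \<in> chambers X"
  obtains w where "red w" "path w c d"
proof -
  let ?r = "coxeter_rel (typeset X) m"
  obtain \<delta> where d: "weyl_distance X m \<delta>" by (rule weyl)
  then have "\<delta> c d \<in> lists (typeset X) // ?r"
    using assms by (simp add: weyl_distance_def coxeter_group_def)
  then obtain v where v: "v \<in> lists (typeset X)" "\<delta> c d = ?r `` {v}" by (rule quotientE)
  then obtain w where w: "(v, w) \<in> ?r" "reduced_word (typeset X) m w"
    using ex_reduced_word by blast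
  have "\<delta> c d = ?r `` {w}" using v equiv_class_eq[OF equiv_coxeter_rel w(1)] by simp
  then have "path w c d"
    using d w(2) assms by (simp add: weyl_distance_def path_gallery)
  with w(2) show ?thesis using that reduced_word_red by blast
qed

text \<open>For a reduced type, a gallery exists exactly when the type represents the Weyl distance;
  so two reduced types are compared inside the Coxeter group.\<close>

lemma path_red_iff:
  assumes "path v c d" "red v" "red w" "w \<in> lists (typeset X)"
  shows "path w c d \<longleftrightarrow> (v, w) \<in> coxeter_rel (typeset X) m"
proof -
  let ?r = "coxeter_rel (typeset X) m"
  obtain \<delta> where d: "weyl_distance X m \<delta>" by (rule weyl)
  have c: "c \<in> chambers X" "d \<in> chambers X" using assms path_chambers by blast+
  have v: "v \<in> lists (typeset X)" using path_set[OF assms(1)] by auto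
  then have "reduced_word (typeset X) m v" "reduced_word (typeset X) m w"
    using assms red_reduced_word by blast+
  then have *: "\<delta> c d = ?r `` {v} \<longleftrightarrow> path v c d" "\<delta> c d = ?r `` {w} \<longleftrightarrow> path w c d"
    using d c by (simp_all add: weyl_distance_def path_gallery)
  then have "path w c d \<longleftrightarrow> ?r `` {v} = ?r `` {w}" using assms(1) by auto
  also have "\<dots> \<longleftrightarrow> (v, w) \<in> ?r"
    by (rule eq_equiv_class_iff[OF equiv_coxeter_rel v assms(4)])
  finally show ?thesis .
qed

lemma path_unique: "path v c d \<Longrightarrow> path w c d \<Longrightarrow> red v \<Longrightarrow> red w \<Longrightarrow> eqv v w"
  using path_red_iff coxeter_rel_eqv path_set by (metis in_listsI subsetD)

lemma path_eqv:
  assumes "path v c d" "red v" "eqv v w" shows "path w c d"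
proof -
  have "w \<in> lists (typeset X)" using path_set[OF assms(1)] eqv_set[OF assms(3)] by auto
  then show ?thesis
    using path_red_iff[OF assms(1,2) red_eqv[OF assms(3,2)]] eqv_coxeter_rel[OF assms(3), of "[]"]
    by simp
qed

text \<open>If \<open>w\<close> is reduced but \<open>i # w\<close> is not, then \<open>i\<close>
  can be moved to the front of \<open>w\<close>. The two consecutive \<open>i\<close>-steps stay in
  one panel and collapse to a single step or to none.\<close>

lemma path_shorten:
  "path w c d \<Longrightarrow> red w \<or> (\<exists>v. path v c d \<and> length v < length w)"
proof (induction w arbitrary: c)
  case (Cons i w)
  then obtain e where e: "i \<in> typeset X" "(c, e) \<in> adj X i" "c \<noteq> e" "path w e d" by auto
  from Cons.IH[OF e(4)] show ?case
  proof
    assume r: "red w"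
    show ?thesis
    proof (cases "initial i w")
      case True
      note q = eqv_remove1[OF True]
      obtain f where f: "(e, f) \<in> adj X i" "path (remove1 i w) f d"
        using path_eqv[OF e(4) r q] by auto
      have "(c, f) \<in> adj X i" using e f adj_trans by blast
      then have "path (remove1 i w) c d \<or> path (i # remove1 i w) c d" using e(1) f(2) by auto
      moreover have "length (remove1 i w) < length (i # w)"
        "length (i # remove1 i w) < length (i # w)" using eqv_length[OF q] by simp_all
      ultimately show ?thesis by blast
    next
      case False
      then show ?thesis using r by (simp add: red_Cons_iff)
    qed
  next
    assume "\<exists>v. path v e d \<and> length v < length w"
    then obtain v where "path v e d" "length v < length w" by blast
    then have "path (i # v) c d" "length (i # v) < length (i # w)" using e by auto
    then show ?thesis by blast
  qed
qed simp

lemma dist_eq_Least: "gdist c d = (LEAST n. \<exists>w. path w c d \<and> length w = n)"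
  unfolding gallery_dist_def path_gallery by metis

lemma dist_le: "path w c d \<Longrightarrow> gdist c d \<le> length w"
  unfolding dist_eq_Least by (intro Least_le) blast

lemma ex_dist_path:
  assumes "c \<in> chambers X" "d \<in> chambers X"
  obtains w where "path w c d" "length w = gdist c d"
proof -
  have "\<exists>n w. path w c d \<and> length w = n" using ex_red_path assms by metis
  from LeastI_ex[OF this] show ?thesis using that unfolding dist_eq_Least by blast
qed

lemma red_if_dist: "path w c d \<Longrightarrow> length w \<le> gdist c d \<Longrightarrow> red w"
  using path_shorten dist_le by fastforce

lemma dist_red:
  assumes "path w c d" "red w" shows "gdist c d = length w"
proof -
  obtain v where v: "path v c d" "length v = gdist c d"
    using ex_dist_path path_chambers[OF assms(1)] by blast
  then have "red v" using red_if_dist by simp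
  with v assms show ?thesis using path_unique eqv_length by metis
qed

text \<open>Completes a square: both types represent the same element of the Coxeter group.\<close>

lemma path_swap:
  assumes "path [i, j] c d" "comm i j" shows "path [j, i] c d"
proof (rule path_eqv[OF assms(1) _ eqv_swap[OF assms(2)]])
  show "red [i, j]" using assms(2) comm_irrefl by (auto simp: red_Cons_iff)
qed

section \<open>Parallel panels\<close>

text \<open>Moving the last letter of \<open>w @ [i]\<close> to the front turns the path from
  \<open>p\<close> to \<open>d\<close> into an \<open>i\<close>-step followed by a path of type
  \<open>w\<close>.\<close>

lemma path_commute_panel:
  assumes p: "path w p c" "red w" and i: "i \<in> typeset X" and w: "\<And>j. j \<in> set w \<Longrightarrow> comm i j"
    and d: "(c, d) \<in> adj X i"
  shows "\<exists>q. (p, q) \<in> adj X i \<and> path w q d"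
proof (cases "d = c")
  case True
  then show ?thesis using p i adj_refl path_chambers by blast
next
  case False
  have iw: "i \<notin> set w" using w comm_irrefl by blast
  then have r: "red (i # w)" using p(2) initial_in_set by (auto simp: red_Cons_iff)
  have e: "eqv (i # w) (w @ [i])" using w by (rule eqv_Cons_snoc)
  have "path (w @ [i]) p d"
    using p(1) d False i path_append path_single by metis
  from path_eqv[OF this red_eqv[OF e r] eqv_sym[OF e]] show ?thesis by auto
qed

text \<open>Prolonging the reversed path by an \<open>i\<close>-step keeps its type reduced, so
  every other chamber of the panel is one step farther from \<open>c\<close> than \<open>p\<close>
  is.\<close>

lemma proj_parallel:
  assumes p: "path w p c" "red w" and i: "i \<in> typeset X" and w: "\<And>j. j \<in> set w \<Longrightarrow> comm i j"
  shows "proj X (panel i p) c = p"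
  unfolding proj_def
proof (rule the_equality)
  have cp: "path (rev w) c p" by (rule path_rev[OF p(1)])
  have far: "gdist c q = Suc (length w)" if q: "(p, q) \<in> adj X i" "q \<noteq> p" for q
  proof -
    have "i \<notin> set w" using w comm_irrefl by blast
    then have "red (i # w)" using p(2) initial_in_set by (auto simp: red_Cons_iff)
    then have "red (rev w @ [i])" using red_rev by fastforce
    moreover have "path (rev w @ [i]) c q"
      using cp q i path_append path_single by metis
    ultimately show ?thesis using dist_red by fastforce
  qed
  have near: "gdist c p = length w" using dist_red[OF cp red_rev[OF p(2)]] by simp
  have "p \<in> panel i p" using adj_refl i path_chambers[OF p(1)] by simp
  then show "is_arg_min (gdist c) (\<lambda>e. e \<in> panel i p) p"
    unfolding is_arg_min_linorder using far near by (metis le_SucI le_refl mem_panel)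
  fix d assume "is_arg_min (gdist c) (\<lambda>e. e \<in> panel i p) d"
  then show "d = p"
    unfolding is_arg_min_linorder using \<open>p \<in> panel i p\<close> far near
    by (metis mem_panel not_less_eq_eq le_refl)
qed

text \<open>Paths of type \<open>w\<close> match the chambers of the two panels, and the projection
  follows this matching. Reversed paths give surjectivity.\<close>

lemma proj_image_parallel:
  assumes p: "path w p c" "red w" and i: "i \<in> typeset X" and w: "\<And>j. j \<in> set w \<Longrightarrow> comm i j"
  shows "proj X (panel i p) ` panel i c = panel i p"
proof -
  have *: "proj X (panel i p) d = q"
    if "path w q d" "(p, q) \<in> adj X i" for d q
    using proj_parallel[OF that(1) p(2) i w] panel_eq[OF that(2) i] by simp
  have "proj X (panel i p) d \<in> panel i p" if "(c, d) \<in> adj X i" for d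
    using path_commute_panel[OF p i w that] * by auto
  moreover have "q \<in> proj X (panel i p) ` panel i c" if q: "(p, q) \<in> adj X i" for q
  proof -
    obtain d where d: "(c, d) \<in> adj X i" "path (rev w) d q"
      using path_commute_panel[OF path_rev[OF p(1)] red_rev[OF p(2)] i _ q] w by auto
    then have "path w q d" using path_rev by fastforce
    with * q d show ?thesis by force
  qed
  ultimately show ?thesis by auto
qed

lemma parallel_panels:
  assumes p: "path w p c" "red w" and i: "i \<in> typeset X" and w: "\<And>j. j \<in> set w \<Longrightarrow> comm i j"
  shows "parallel X (panel i p) (panel i c)"
  unfolding parallel_def
  using proj_image_parallel[OF p i w]
    proj_image_parallel[OF path_rev[OF p(1)] red_rev[OF p(2)] i] w by simp

end

section \<open>Gates of panel-closed sets\<close>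

locale panel_closed_set = ra_building X m
  for X :: "('i, 'c) chamber_system" and m +
  fixes C :: "'c set"
  assumes pc: "panel_closed X C" and C_nonempty: "C \<noteq> {}"
begin

lemma C_chambers: "c \<in> C \<Longrightarrow> c \<in> chambers X"
  using pc by (auto simp: panel_closed_def)

lemma C_panel:
  assumes "c \<in> C" "d \<in> C" "c \<noteq> d" "(c, d) \<in> adj X i" "(c, e) \<in> adj X i" "i \<in> typeset X"
  shows "e \<in> C"
proof -
  have "is_panel X i (panel i c)" using assms C_chambers is_panel_panel by blast
  moreover have "c \<in> panel i c" using assms C_chambers adj_refl by simp
  ultimately have "panel i c \<subseteq> C"
    using pc assms unfolding panel_closed_def by (meson IntI mem_panel)
  with assms show ?thesis by auto
qed

lemma C_convex:
  assumes "c \<in> C" "d \<in> C" "(c, e) \<in> adj X i" "c \<noteq> e" "i \<in> typeset X" "path w e d" "red (i # w)"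
  shows "e \<in> C"
proof -
  obtain cs where cs: "gallery_between X w cs e d" using assms(6) path_gallery by blast
  then have "cs \<noteq> []" "hd cs = e" by (auto simp: gallery_between_def gallery_def)
  then have "gallery_between X (i # w) (c # cs) c d"
    using cs assms gallery_ConsI by (auto simp: gallery_between_def)
  moreover have "path (i # w) c d" using assms by auto
  then have "gdist c d = length (i # w)" using dist_red assms by blast
  ultimately have "minimal_gallery X (c # cs) c d" unfolding minimal_gallery_def by metis
  then have "set (c # cs) \<subseteq> C"
    using pc assms unfolding panel_closed_def convex_def by blast
  with \<open>cs \<noteq> []\<close> \<open>hd cs = e\<close> show ?thesis by (metis hd_in_set list.set_intros(2) subsetD)
qed

text \<open>As \<open>C\<close> is nonempty, this infimum of natural numbers is attained.\<close>

definition level :: "'c \<Rightarrow> nat" where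
  "level x = Inf (gdist x ` C)"

lemma level_le: "path w x c \<Longrightarrow> c \<in> C \<Longrightarrow> level x \<le> length w"
  unfolding level_def by (meson cINF_lower dist_le le_trans bdd_below_bot)

lemma ex_gate:
  assumes "x \<in> chambers X"
  obtains c w where "c \<in> C" "path w x c" "length w = level x"
proof -
  have "level x \<in> gdist x ` C" unfolding level_def by (rule Inf_nat_def1) (simp add: C_nonempty)
  then obtain c where "c \<in> C" "gdist x c = level x" by auto
  then show ?thesis using ex_dist_path[of x c] assms C_chambers that by metis
qed

lemma gate_red:
  assumes "path w x c" "length w = level x" "c \<in> C"
  shows "red w"
  using path_shorten[OF assms(1)] level_le[OF _ assms(3)] assms(2) by fastforce

lemma level_eq_0_iff:
  assumes "x \<in> chambers X" shows "level x = 0 \<longleftrightarrow> x \<in> C"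
proof
  assume "level x = 0"
  then show "x \<in> C" using ex_gate[OF assms] by (metis length_0_conv path.simps(1))
next
  assume "x \<in> C"
  then show "level x = 0" using level_le[of "[]" x x] assms by simp
qed

text \<open>Suppose a letter \<open>k\<close> cancels between \<open>w\<close> and \<open>v\<close>.
  By convexity a \<open>k\<close>-step from \<open>c\<close> stays in \<open>C\<close>, so the whole
  \<open>k\<close>-panel of \<open>c\<close> lies in \<open>C\<close>. It contains the last chamber
  but one of a rearranged path to \<open>c\<close>, so \<open>x\<close> would be closer to
  \<open>C\<close> than its level.\<close>

lemma gate_append_red:
  assumes w: "path w x c" "length w = level x" and c: "c \<in> C" and e: "e \<in> C"
    and v: "path v c e" "red v"
  shows "red (w @ v)"
proof (rule ccontr)
  assume "\<not> red (w @ v)"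
  then obtain k w' v' where k: "eqv w (w' @ [k])" "eqv v (k # v')"
    using not_red_appendE gate_red[OF w c] v by blast
  obtain y where y: "path w' x y" "k \<in> typeset X" "(y, c) \<in> adj X k"
    using path_eqv[OF w(1) gate_red[OF w c] k(1)] path_append path_single by metis
  obtain z where z: "(c, z) \<in> adj X k" "c \<noteq> z" "path v' z e"
    using path_eqv[OF v k(2)] by auto
  have "z \<in> C" using C_convex[OF c e z(1,2) y(2) z(3)] red_eqv[OF k(2) v(2)] by blast
  then have "y \<in> C" using C_panel[OF c _ z(2,1) adj_sym[OF y(3,2)] y(2)] by blast
  then have "level x \<le> length w'" using level_le y by blast
  then show False using eqv_length[OF k(1)] w(2) by simp
qed

text \<open>For a reduced \<open>u\<close> from \<open>c\<close> to \<open>d\<close> the type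
  \<open>w @ u\<close> is reduced, so \<open>d\<close> is farther from \<open>x\<close> than
  \<open>c\<close> unless \<open>u\<close> is empty.\<close>

lemma gate_unique:
  assumes w: "path w x c" "length w = level x" "c \<in> C"
    and v: "path v x d" "length v = level x" "d \<in> C"
  shows "c = d"
proof -
  obtain u where u: "red u" "path u c d" using ex_red_path w v C_chambers by metis
  have "red (w @ u)" using gate_append_red w v u by blast
  moreover have "path (w @ u) x d" using w u path_append by blast
  ultimately have "gdist x d = length (w @ u)" using dist_red by blast
  then have "u = []" using dist_le[OF v(1)] w v by simp
  with u show ?thesis by simp
qed

section \<open>Levels on panels\<close>

lemma level_adj:
  assumes "(x, y) \<in> adj X i" "i \<in> typeset X" shows "level x \<le> Suc (level y)"
proof (cases "x = y")
  case False
  obtain c w where c: "c \<in> C" "path w y c" "length w = level y"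
    using ex_gate adj_chambers assms by metis
  then have "path (i # w) x c" using assms False by auto
  from level_le[OF this c(1)] c show ?thesis by simp
qed simp

lemma ex_descent:
  assumes "x \<in> chambers X" "level x = Suc n"
  obtains i y where "i \<in> typeset X" "(y, x) \<in> adj X i" "level y = n"
proof -
  obtain c w where c: "c \<in> C" "path w x c" "length w = level x" using ex_gate assms by metis
  then obtain i v y where v: "w = i # v" "i \<in> typeset X" "(x, y) \<in> adj X i" "path v y c"
    using assms by (cases w) auto
  have "level y \<le> n" using level_le[OF v(4) c(1)] c v assms by simp
  moreover have "Suc n \<le> Suc (level y)" using level_adj[OF v(3,2)] assms by simp
  ultimately show ?thesis using that[OF v(2) adj_sym[OF v(3,2)]] by simp
qed

text \<open>
  The gate of \<open>q\<close> is adjacent to \<open>c\<close>, say of type \<open>k\<close>, so \<open>q\<close> and \<open>c\<close> are joined by reduced paths of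
  types \<open>i # w\<close> and \<open>u @ [k]\<close>; the last letter \<open>k\<close> cannot come from \<open>w\<close>, so it is the first letter \<open>i\<close>.
\<close>

lemma equal_level_parallel:
  assumes pq: "(p, q) \<in> adj X i" "p \<noteq> q" "level q = level p" and i: "i \<in> typeset X"
    and w: "path w p c" "length w = level p" "c \<in> C" "\<not> initial i w"
  shows "\<forall>j\<in>set w. comm i j" "panel i c \<subseteq> C"
proof -
  have r: "red (i # w)" using gate_red[OF w(1,2,3)] w(4) by (simp add: red_Cons_iff)
  have qc: "path (i # w) q c" using pq adj_sym i w by auto
  obtain e u where e: "e \<in> C" "path u q e" "length u = level q"
    using ex_gate adj_chambers pq i by metis
  obtain v where v: "red v" "path v e c" using ex_red_path e w C_chambers by metis
  have "red (u @ v)" using gate_append_red e w v by blast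
  moreover have "path (u @ v) q c" using e v path_append by blast
  ultimately have uv: "eqv (i # w) (u @ v)" using path_unique qc r by blast
  then have "length v = 1" using eqv_length e pq w by fastforce
  then obtain k where k: "v = [k]" by (metis One_nat_def length_0_conv length_Suc_conv)
  have ec: "(c, e) \<in> adj X k" "c \<noteq> e" "k \<in> typeset X"
    using v k path_single adj_sym by blast+
  have C: "z \<in> C" if "(c, z) \<in> adj X k" for z
    using C_panel[OF w(3) e(1) ec(2,1) that ec(3)] .
  have "k = i \<and> (\<forall>j\<in>set w. comm i j)"
  proof (rule eqv_Cons_snocE)
    show "eqv (i # w) (u @ [k])" using uv k by simp
  next
    \<comment> \<open>Here the chamber before \<open>c\<close> on a rearranged path from
      \<open>p\<close> lies in the \<open>k\<close>-panel of \<open>c\<close>, which is contained in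
      \<open>C\<close>; this contradicts the level of \<open>p\<close>.\<close>
    fix w' assume e': "eqv w (w' @ [k])"
    obtain z where z: "path w' p z" "(z, c) \<in> adj X k"
      using path_eqv[OF w(1) gate_red[OF w(1,2,3)] e'] path_append path_single by metis
    have "z \<in> C" using C adj_sym z ec by blast
    from level_le[OF z(1) this] show ?thesis using eqv_length[OF e'] w by simp
  next
    assume "k = i" "\<And>j. j \<in> set w \<Longrightarrow> comm i j"
    then show ?thesis by blast
  qed
  then show "\<forall>j\<in>set w. comm i j" "panel i c \<subseteq> C" using C by auto
qed

text \<open>Two different lower neighbours of equal level make the panel parallel to an
  \<open>i\<close>-panel inside \<open>C\<close>. Moving the \<open>i\<close>-step of the path
  \<open>i # w\<close> from \<open>x\<close> to the end then shows that \<open>C\<close> is reached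
  already after \<open>w\<close>.\<close>

lemma descent_unique:
  assumes i: "i \<in> typeset X" and y: "(y, x) \<in> adj X i" and z: "(z, x) \<in> adj X i"
    and l: "level y = level z" "level x = Suc (level y)"
  shows "y = z"
proof (rule ccontr)
  assume ne: "y \<noteq> z"
  have yz: "(y, z) \<in> adj X i" using y z adj_sym adj_trans i by blast
  obtain c w where c: "c \<in> C" "path w y c" "length w = level y"
    using ex_gate adj_chambers y i by metis
  have "x \<noteq> y" using l by auto
  \<comment> \<open>An initial \<open>i\<close> would lead to a chamber of the same panel below the
    level of \<open>y\<close>, too close to \<open>C\<close> to be adjacent to
    \<open>x\<close>.\<close>
  have "\<not> initial i w"
  proof
    assume "initial i w"
    from eqv_remove1[OF this] have e: "eqv w (i # remove1 i w)" .
    obtain v where v: "(y, v) \<in> adj X i" "path (remove1 i w) v c"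
      using path_eqv[OF c(2) gate_red[OF c(2,3,1)] e] by auto
    have "level x \<le> Suc (level v)"
      using level_adj[OF _ i] v y adj_sym adj_trans i by blast
    moreover have "level v \<le> length (remove1 i w)" using level_le v c by blast
    ultimately show False using eqv_length[OF e] c l by simp
  qed
  note e = equal_level_parallel[OF yz ne l(1)[symmetric] i c(2,3,1) this]
  have eq: "eqv (i # w) (w @ [i])" using e(1) by (intro eqv_Cons_snoc) blast
  have p: "path (i # w) x c" using c y adj_sym i \<open>x \<noteq> y\<close> by auto
  have "red (i # w)" using gate_red[OF c(2,3,1)] \<open>\<not> initial i w\<close> by (simp add: red_Cons_iff)
  from path_eqv[OF p this eq] obtain d where d: "path w x d" "(d, c) \<in> adj X i"
    using path_append path_single by metis
  have "d \<in> C" using e(2) d adj_sym i by auto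
  then show False using level_le[OF d(1)] c l by simp
qed

text \<open>Let \<open>p\<close> minimise the level on the panel. Levels of adjacent chambers differ
  by at most one, and a second minimum next to a higher chamber would contradict
  \<open>descent_unique\<close>.\<close>

lemma panel_level_cases:
  assumes i: "i \<in> typeset X" and x: "x \<in> chambers X"
  obtains (gate) p where "(x, p) \<in> adj X i"
      "\<And>q. (x, q) \<in> adj X i \<Longrightarrow> q \<noteq> p \<Longrightarrow> level q = Suc (level p)"
    | (const) "\<And>q. (x, q) \<in> adj X i \<Longrightarrow> level q = level x"
proof -
  define p where "p = (ARG_MIN level p. (x, p) \<in> adj X i)"
  have p: "(x, p) \<in> adj X i"
    unfolding p_def by (rule arg_min_natI, rule adj_refl[OF i x])
  have min: "level p \<le> level q" if "(x, q) \<in> adj X i" for q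
    unfolding p_def using that by (rule arg_min_nat_le)
  have adj: "(q, r) \<in> adj X i" if "(x, q) \<in> adj X i" "(x, r) \<in> adj X i" for q r
    using that adj_sym adj_trans i by blast
  show ?thesis
  proof (cases "\<exists>q. (x, q) \<in> adj X i \<and> q \<noteq> p \<and> level q = level p")
    case True
    then obtain q where q: "(x, q) \<in> adj X i" "q \<noteq> p" "level q = level p" by blast
    have "level r = level p" if r: "(x, r) \<in> adj X i" for r
    proof (rule ccontr)
      assume "level r \<noteq> level p"
      then have "level r = Suc (level p)"
        using min[OF r] level_adj[OF adj[OF r p] i] by simp
      then show False
        using descent_unique[OF i adj[OF q(1) r] adj[OF p r]] q by simp
    qed
    then have "level r = level x" if "(x, r) \<in> adj X i" for r
      using that adj_refl[OF i x] by simp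
    then show ?thesis by (rule const)
  next
    case False
    then have "level q = Suc (level p)" if "(x, q) \<in> adj X i" "q \<noteq> p" for q
      using that min[OF that(1)] level_adj[OF adj[OF that(1) p] i] by (metis le_SucE le_antisym)
    with p show ?thesis by (rule gate)
  qed
qed

text \<open>An initial \<open>i\<close> in \<open>w\<close> would produce a chamber of smaller level
  in the panel; hence \<open>equal_level_parallel\<close> applies to \<open>x\<close> and any other
  chamber of its panel.\<close>

lemma const_panel:
  assumes i: "i \<in> typeset X" and x: "x \<in> chambers X"
    and const: "\<And>q. (x, q) \<in> adj X i \<Longrightarrow> level q = level x"
    and w: "path w x c" "length w = level x" "c \<in> C"
  shows "\<forall>j\<in>set w. comm i j" "panel i c \<subseteq> C"
proof -
  obtain q where q: "(x, q) \<in> adj X i" "x \<noteq> q" using ex_adj_neq[OF i x] by blast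
  have "\<not> initial i w"
  proof
    assume "initial i w"
    from eqv_remove1[OF this] have e: "eqv w (i # remove1 i w)" .
    obtain v where v: "(x, v) \<in> adj X i" "path (remove1 i w) v c"
      using path_eqv[OF w(1) gate_red[OF w] e] by auto
    show False using level_le[OF v(2) w(3)] const[OF v(1)] eqv_length[OF e] w by simp
  qed
  from equal_level_parallel[OF q const[OF q(1)] i w this]
  show "\<forall>j\<in>set w. comm i j" "panel i c \<subseteq> C" .
qed

text \<open>Descending through \<open>y\<close> or \<open>z\<close> leads to the same gate, so
  \<open>i # u\<close> and \<open>j # w\<close> are equivalent; hence \<open>j\<close> is initial in
  \<open>u\<close> and commutes with \<open>i\<close>. Swapping the first two steps of the path
  through \<open>y\<close> gives a lower \<open>j\<close>-neighbour of \<open>x\<close>, which is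
  \<open>z\<close> by \<open>descent_unique\<close>.\<close>

lemma diamond:
  assumes i: "i \<in> typeset X" and j: "j \<in> typeset X" and ij: "i \<noteq> j"
    and y: "(y, x) \<in> adj X i" "level x = Suc (level y)"
    and z: "(z, x) \<in> adj X j" "level x = Suc (level z)"
  obtains v where "comm i j" "(v, y) \<in> adj X j" "level y = Suc (level v)"
    "(v, z) \<in> adj X i" "level z = Suc (level v)"
proof -
  obtain c u where c: "c \<in> C" "path u y c" "length u = level y"
    using ex_gate adj_chambers y i by metis
  obtain d w where d: "d \<in> C" "path w z d" "length w = level z"
    using ex_gate adj_chambers z j by metis
  have ne: "x \<noteq> y" "x \<noteq> z" using y z by auto
  have xc: "path (i # u) x c" using c(2) adj_sym[OF y(1) i] i ne by auto
  have xd: "path (j # w) x d" using d(2) adj_sym[OF z(1) j] j ne by auto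
  have len: "length (i # u) = level x" "length (j # w) = level x" using c d y z by simp_all
  have "c = d" by (rule gate_unique[OF xc len(1) c(1) xd len(2) d(1)])
  have r: "red (i # u)" "red (j # w)"
    using gate_red[OF xc len(1) c(1)] gate_red[OF xd len(2) d(1)] by blast+
  have "eqv (j # w) (i # u)" using path_unique[OF xd] xc r \<open>c = d\<close> by blast
  from eqv_ConsD(1)[OF this] have ji: "comm j i" "initial j u" using ij by auto
  from eqv_remove1[OF this(2)] have e: "eqv u (j # remove1 j u)" .
  obtain v where v: "(y, v) \<in> adj X j" "y \<noteq> v" "path (remove1 j u) v c"
    using path_eqv[OF c(2) gate_red[OF c(2,3,1)] e] by auto
  have lv: "level y = Suc (level v)"
    using level_le[OF v(3) c(1)] level_adj[OF v(1) j] eqv_length[OF e] c by simp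
  have "path [i, j] x v"
    using adj_sym[OF y(1) i] v(1,2) ne i j adj_chambers[OF v(1) j] by auto
  from path_swap[OF this comm_sym[OF ji(1)]]
  obtain z' where z': "(x, z') \<in> adj X j" "(z', v) \<in> adj X i" by auto
  have "level z' = level z"
    using level_adj[OF z'(1) j] level_adj[OF z'(2) i] lv y z by simp
  from descent_unique[OF j z(1) adj_sym[OF z'(1) j] this[symmetric] z(2)]
  have "z = z'" .
  moreover have "level z = Suc (level v)" using lv y(2) z(2) by linarith
  ultimately show ?thesis
    using that[OF comm_sym[OF ji(1)] adj_sym[OF v(1) j] lv] adj_sym[OF z'(2) i] by blast
qed

end

section \<open>Legal colorings\<close>

locale colored_building = ra_building X m
  for X :: "('i, 'c) chamber_system" and m +
  fixes \<Omega> :: "'i \<Rightarrow> 'a set" and lam :: "'i \<Rightarrow> 'c \<Rightarrow> 'a"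
  assumes legal: "legal_coloring X \<Omega> lam"
begin

lemma lam_bij: "i \<in> typeset X \<Longrightarrow> c \<in> chambers X \<Longrightarrow> bij_betw (lam i) (panel i c) (\<Omega> i)"
  using legal is_panel_panel by (auto simp: legal_coloring_def)

lemma lam_mem: "i \<in> typeset X \<Longrightarrow> c \<in> chambers X \<Longrightarrow> lam i c \<in> \<Omega> i"
  using legal by (auto simp: legal_coloring_def)

lemma lam_adj:
  assumes "(c, d) \<in> adj X i" "i \<in> typeset X" "j \<in> typeset X" "j \<noteq> i"
  shows "lam j c = lam j d"
proof -
  have c: "c \<in> chambers X" using adj_chambers assms by blast
  have "\<forall>x\<in>panel i c. \<forall>y\<in>panel i c. lam j x = lam j y"
    using legal is_panel_panel[OF assms(2) c] assms unfolding legal_coloring_def by blast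
  then show ?thesis using assms(1) adj_refl[OF assms(2) c] mem_panel by blast
qed

text \<open>The elementary move from which the extension is assembled; it leaves all colors of types
  other than \<open>i\<close> unchanged.\<close>

definition recolor :: "'i \<Rightarrow> 'a \<Rightarrow> 'c \<Rightarrow> 'c" where
  "recolor i a c = the_inv_into (panel i c) (lam i) a"

lemma recolor_bij:
  "i \<in> typeset X \<Longrightarrow> c \<in> chambers X \<Longrightarrow> bij_betw (\<lambda>a. recolor i a c) (\<Omega> i) (panel i c)"
  unfolding recolor_def using bij_betw_the_inv_into[OF lam_bij] .

lemma recolor_adj:
  "i \<in> typeset X \<Longrightarrow> c \<in> chambers X \<Longrightarrow> a \<in> \<Omega> i \<Longrightarrow> (c, recolor i a c) \<in> adj X i"
  using bij_betwE[OF recolor_bij] by simp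

lemma recolor_chambers:
  "i \<in> typeset X \<Longrightarrow> c \<in> chambers X \<Longrightarrow> a \<in> \<Omega> i \<Longrightarrow> recolor i a c \<in> chambers X"
  using recolor_adj adj_chambers by blast

lemma lam_recolor:
  "i \<in> typeset X \<Longrightarrow> c \<in> chambers X \<Longrightarrow> a \<in> \<Omega> i \<Longrightarrow> lam i (recolor i a c) = a"
  unfolding recolor_def using f_the_inv_into_f_bij_betw[OF lam_bij] by blast

lemma lam_recolor_other:
  "i \<in> typeset X \<Longrightarrow> c \<in> chambers X \<Longrightarrow> a \<in> \<Omega> i \<Longrightarrow> k \<in> typeset X \<Longrightarrow> k \<noteq> i \<Longrightarrow>
    lam k (recolor i a c) = lam k c"
  using lam_adj[OF recolor_adj] by metis

lemma recolor_lam: "(c, d) \<in> adj X i \<Longrightarrow> i \<in> typeset X \<Longrightarrow> recolor i (lam i d) c = d"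
  unfolding recolor_def using the_inv_into_f_f[OF bij_betw_imp_inj_on[OF lam_bij]] adj_chambers
  by (metis mem_panel)

lemma recolor_eqI:
  "(c, d) \<in> adj X i \<Longrightarrow> i \<in> typeset X \<Longrightarrow> lam i d = a \<Longrightarrow> recolor i a c = d"
  using recolor_lam by blast

text \<open>The two moves span a square, whose corners are identified by their colors because an
  \<open>i\<close>-step preserves the \<open>j\<close>-color and conversely.\<close>

lemma recolor_commute:
  assumes ij: "comm i j" and c: "c \<in> chambers X" and a: "a \<in> \<Omega> i" and b: "b \<in> \<Omega> j"
  shows "recolor i a (recolor j b c) = recolor j b (recolor i a c)"
proof -
  have t: "i \<in> typeset X" "j \<in> typeset X" "i \<noteq> j" using ij by (auto simp: comm_def)
  define e where "e = recolor j b c"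
  define d where "d = recolor i a e"
  have e: "(c, e) \<in> adj X j" "e \<in> chambers X" "lam j e = b" "lam i e = lam i c"
    using recolor_adj recolor_chambers lam_recolor lam_recolor_other t c b
    unfolding e_def by auto
  have d: "(e, d) \<in> adj X i" "d \<in> chambers X" "lam i d = a" "lam j d = b"
    using recolor_adj recolor_chambers lam_recolor lam_recolor_other t e a
    unfolding d_def by auto
  have "recolor j b (recolor i a c) = d"
  \<comment> \<open>A path has no stationary steps, so moves that fix the chamber are treated
    apart.\<close>
  proof (cases "c = e \<or> e = d")
    case True
    then show ?thesis
    proof
      assume "c = e"
      then have "recolor i a c = d" by (simp add: d_def)
      then show ?thesis using recolor_eqI[OF adj_refl] t d by simp
    next
      assume "e = d"
      then have "recolor i a c = c" using recolor_eqI[OF adj_refl] t d e c by simp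
      then show ?thesis using \<open>e = d\<close> by (simp add: e_def)
    qed
  next
    case False
    then have "path [j, i] c d" using e d t by auto
    from path_swap[OF this comm_sym[OF ij]]
    obtain f where f: "(c, f) \<in> adj X i" "(f, d) \<in> adj X j" by auto
    have "lam i f = a" using lam_adj[OF f(2)] t d by simp
    then have "recolor i a c = f" using recolor_eqI[OF f(1)] t by blast
    then show ?thesis using recolor_eqI[OF f(2)] t d by blast
  qed
  then show ?thesis by (simp add: d_def e_def)
qed

text \<open>The inverse recolors back to the \<open>j\<close>-color of \<open>c\<close>, which is
  shared by the whole \<open>i\<close>-panel of \<open>c\<close>.\<close>

lemma recolor_panel_bij:
  assumes ij: "comm i j" and c: "c \<in> chambers X" and b: "b \<in> \<Omega> j"
  shows "bij_betw (recolor j b) (panel i c) (panel i (recolor j b c))"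
proof -
  have t: "i \<in> typeset X" "j \<in> typeset X" "i \<noteq> j" using ij by (auto simp: comm_def)
  have maps: "recolor j b q \<in> panel i (recolor j b c)"
    if c: "c \<in> chambers X" and b: "b \<in> \<Omega> j" and q: "q \<in> panel i c" for b c q
  proof -
    have "q = recolor i (lam i q) c" using recolor_lam t q by simp
    then have "recolor j b q = recolor i (lam i q) (recolor j b c)"
      using recolor_commute[OF ij c _ b] lam_mem[OF t(1)] adj_chambers[OF _ t(1)] q
      by (metis mem_panel)
    then show ?thesis
      using recolor_adj[OF t(1) recolor_chambers[OF t(2) c b]]
        lam_mem[OF t(1)] adj_chambers(2)[OF _ t(1)] q by (metis mem_panel)
  qed
  have inv: "recolor j (lam j c) (recolor j b q) = q"
    if c: "c \<in> chambers X" and b: "b \<in> \<Omega> j" and q: "q \<in> panel i c" for b c q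
  proof (rule recolor_eqI)
    have "q \<in> chambers X" using q adj_chambers t by auto
    then show "(recolor j b q, q) \<in> adj X j" using recolor_adj adj_sym t b by blast
    show "lam j q = lam j c" using lam_adj q t by fastforce
  qed (rule t(2))
  let ?c = "recolor j b c"
  have c': "?c \<in> chambers X" "lam j c \<in> \<Omega> j" "recolor j (lam j c) ?c = c" "lam j ?c = b"
    using recolor_chambers[OF t(2) c b] lam_mem[OF t(2) c] inv[OF c b]
      adj_refl[OF t(1) c] lam_recolor[OF t(2) c b] by simp_all
  show ?thesis
  proof (rule bij_betw_byWitness[where f' = "recolor j (lam j c)"])
    show "\<forall>q\<in>panel i c. recolor j (lam j c) (recolor j b q) = q" using inv c b by blast
    show "\<forall>q\<in>panel i ?c. recolor j b (recolor j (lam j c) q) = q"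
      using inv[OF c'(1,2)] c'(4) by simp
    show "recolor j b ` panel i c \<subseteq> panel i ?c" using maps c b by blast
    show "recolor j (lam j c) ` panel i ?c \<subseteq> panel i c" using maps[OF c'(1,2)] c'(3) by auto
  qed
qed

text \<open>Two colors \<open>f x\<close> and \<open>f' x\<close> of one orbit are related by the
  product of \<open>f'\<close> with the inverse of \<open>f\<close>. Conversely, the identity puts
  the color of \<open>c\<close> into its own orbit.\<close>

lemma harmonious_iff:
  assumes F: "local_data (typeset X) \<Omega> F" and c: "c \<in> chambers X"
  shows "harmonious (typeset X) \<Omega> lam F c d \<longleftrightarrow>
    (\<forall>k\<in>typeset X. \<exists>f\<in>F k. f (lam k c) = lam k d)"
proof -
  have "(\<exists>orb \<in> orbits (BijGroup (\<Omega> k)\<lparr>carrier := F k\<rparr>) (\<Omega> k) (\<lambda>f. f).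
      lam k c \<in> orb \<and> lam k d \<in> orb) \<longleftrightarrow> (\<exists>f\<in>F k. f (lam k c) = lam k d)" (is "?L \<longleftrightarrow> ?R")
    if k: "k \<in> typeset X" for k
  proof
    let ?G = "BijGroup (\<Omega> k)"
    interpret G: group ?G by (rule group_BijGroup)
    have sub: "subgroup (F k) ?G" using F k by (simp add: local_data_def)
    {
      assume ?L
      then obtain x f f' where x: "x \<in> \<Omega> k" and f: "f \<in> F k" "f' \<in> F k"
        and eq: "lam k c = f x" "lam k d = f' x"
        by (auto simp: orbits_def orbit_def)
      have cl: "f \<in> carrier ?G" "f' \<in> carrier ?G"
        using subgroup.mem_carrier[OF sub] f by blast+
      obtain h where h: "h \<in> F k" "h \<otimes>\<^bsub>?G\<^esub> f = f'"
      proof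
        show "f' \<otimes>\<^bsub>?G\<^esub> inv\<^bsub>?G\<^esub> f \<in> F k"
          using sub f by (simp add: subgroup.m_closed subgroup.m_inv_closed)
        show "f' \<otimes>\<^bsub>?G\<^esub> inv\<^bsub>?G\<^esub> f \<otimes>\<^bsub>?G\<^esub> f = f'"
          using cl by (simp add: G.m_assoc)
      qed
      then have "compose (\<Omega> k) h f = f'"
        using cl subgroup.mem_carrier[OF sub h(1)] by (simp add: BijGroup_def)
      then have "h (f x) = f' x" using x by (metis compose_eq)
      then show ?R using h(1) eq by auto
    next
      assume ?R
      then obtain f where f: "f \<in> F k" "f (lam k c) = lam k d" by blast
      have "(\<lambda>x\<in>\<Omega> k. x) \<in> F k" using subgroup.one_closed[OF sub] by (simp add: BijGroup_def)
      moreover have m: "lam k c \<in> \<Omega> k" using lam_mem k c by blast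
      ultimately obtain e where e: "e \<in> F k" "e (lam k c) = lam k c" by force
      let ?orb = "orbit (?G\<lparr>carrier := F k\<rparr>) (\<lambda>f. f) (lam k c)"
      have "?orb \<in> orbits (?G\<lparr>carrier := F k\<rparr>) (\<Omega> k) (\<lambda>f. f)"
        unfolding orbits_def using m by blast
      moreover have mem: "h (lam k c) \<in> ?orb" if "h \<in> F k" for h
        unfolding orbit_def using that by auto
      have "lam k c \<in> ?orb" "lam k d \<in> ?orb" using mem[OF e(1)] mem[OF f(1)] e(2) f(2) by simp_all
      ultimately show ?L by blast
    }
  qed
  then show ?thesis unfolding harmonious_def by blast
qed

end

section \<open>Extending the automorphism\<close>

locale harmonious_automorphism =
  panel_closed_set X m C + colored_building X m \<Omega> lam
  for X :: "('i, 'c) chamber_system" and m C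
    and \<Omega> :: "'i \<Rightarrow> 'a set" and lam +
  fixes F :: "'i \<Rightarrow> ('a \<Rightarrow> 'a) set" and g :: "'c \<Rightarrow> 'c"
  assumes F: "local_data (typeset X) \<Omega> F"
    and g: "g \<in> Aut X"
    and g_harmonious: "c \<in> C \<Longrightarrow> harmonious (typeset X) \<Omega> lam F c (g c)"
begin

section \<open>Construction of the extension\<close>

text \<open>The choice depends on the type and two colors only, never on chambers; this is what
  makes different routes to a chamber agree.\<close>

definition perm :: "'i \<Rightarrow> 'a \<Rightarrow> 'a \<Rightarrow> 'a \<Rightarrow> 'a" where
  "perm i a b = (SOME f. f \<in> F i \<and> f a = b)"

lemma perm:
  assumes "\<exists>f\<in>F i. f a = b" shows "perm i a b \<in> F i" "perm i a b a = b"
  using someI_ex[of "\<lambda>f. f \<in> F i \<and> f a = b"] assms unfolding perm_def by blast+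

lemma F_Bij: "i \<in> typeset X \<Longrightarrow> f \<in> F i \<Longrightarrow> f \<in> Bij (\<Omega> i)"
  using F subgroup.mem_carrier by (fastforce simp: local_data_def BijGroup_def)

lemma F_mem: "i \<in> typeset X \<Longrightarrow> f \<in> F i \<Longrightarrow> a \<in> \<Omega> i \<Longrightarrow> f a \<in> \<Omega> i"
  using F_Bij Bij_imp_funcset by blast

text \<open>The level is a separate argument so that the recursion is primitive; the intended use is
  with \<open>level x\<close> as first argument. The pair \<open>(i, y)\<close> is an arbitrary
  descent from \<open>x\<close>.\<close>

primrec ext_at :: "nat \<Rightarrow> 'c \<Rightarrow> 'c" where
  "ext_at 0 x = g x"
| "ext_at (Suc n) x =
    (let (i, y) = SOME (i, y). i \<in> typeset X \<and> (y, x) \<in> adj X i \<and> level y = n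
     in recolor i (perm i (lam i y) (lam i (ext_at n y)) (lam i x)) (ext_at n y))"

definition ext :: "'c \<Rightarrow> 'c" where
  "ext x = ext_at (level x) x"

definition step :: "'i \<Rightarrow> 'c \<Rightarrow> 'c \<Rightarrow> 'c" where
  "step i y x = recolor i (perm i (lam i y) (lam i (ext y)) (lam i x)) (ext y)"

lemma ext_C: "x \<in> C \<Longrightarrow> ext x = g x"
  using level_eq_0_iff[OF C_chambers] by (simp add: ext_def)

lemma ext_chosen:
  assumes "x \<in> chambers X" "level x = Suc n"
  obtains i y where "i \<in> typeset X" "(y, x) \<in> adj X i" "level y = n" "ext x = step i y x"
proof -
  define P where "P = (\<lambda>(i, y). i \<in> typeset X \<and> (y, x) \<in> adj X i \<and> level y = n)"
  obtain i y where iy: "(SOME p. P p) = (i, y)" by fastforce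
  have "\<exists>p. P p" by (rule ex_descent[OF assms]) (auto simp: P_def)
  from someI_ex[OF this] iy have "P (i, y)" by simp
  then have *: "i \<in> typeset X" "(y, x) \<in> adj X i" "level y = n" by (simp_all add: P_def)
  have "ext x = step i y x"
    using iy *(3) assms(2) unfolding ext_def step_def P_def by simp
  with * that show ?thesis by blast
qed

lemma g_chambers: "x \<in> chambers X \<Longrightarrow> g x \<in> chambers X"
  using g Bij_imp_funcset by (fastforce simp: Aut_def)

text \<open>Harmony is proved along the recursion because it supplies the permutation required at
  the next level. A step changes only the \<open>i\<close>-color, and by an element of
  \<open>F i\<close>.\<close>

lemma ext_invariant:
  "x \<in> chambers X \<Longrightarrow>
    ext x \<in> chambers X \<and> (\<forall>k\<in>typeset X. \<exists>f\<in>F k. f (lam k x) = lam k (ext x))"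
proof (induction "level x" arbitrary: x)
  case 0
  then have "x \<in> C" using level_eq_0_iff by simp
  from g_harmonious[OF this]
  have "\<forall>k\<in>typeset X. \<exists>f\<in>F k. f (lam k x) = lam k (g x)"
    unfolding harmonious_iff[OF F "0.prems"] .
  with ext_C[OF \<open>x \<in> C\<close>] g_chambers[OF "0.prems"] show ?case by simp
next
  case (Suc n)
  obtain i y where i: "i \<in> typeset X" and y: "(y, x) \<in> adj X i" "level y = n"
    and eq: "ext x = step i y x"
    using ext_chosen Suc by metis
  have yc: "y \<in> chambers X" using adj_chambers y i by blast
  with Suc.hyps(1) y(2) have IH: "ext y \<in> chambers X"
    "\<And>k. k \<in> typeset X \<Longrightarrow> \<exists>f\<in>F k. f (lam k y) = lam k (ext y)" by auto
  let ?f = "perm i (lam i y) (lam i (ext y))"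
  have f: "?f \<in> F i" by (rule perm(1)[OF IH(2)[OF i]])
  have a: "?f (lam i x) \<in> \<Omega> i" by (rule F_mem[OF i f lam_mem[OF i Suc.prems]])
  have "\<exists>f\<in>F k. f (lam k x) = lam k (ext x)" if k: "k \<in> typeset X" for k
  proof (cases "k = i")
    case True
    have "?f (lam k x) = lam k (ext x)" using True lam_recolor[OF i IH(1) a] eq by (simp add: step_def)
    with f True show ?thesis by blast
  next
    case False
    have "lam k (ext x) = lam k (ext y)" "lam k x = lam k y"
      using lam_recolor_other[OF i IH(1) a k False] lam_adj[OF y(1) i k False] eq
      by (simp_all add: step_def)
    with IH(2)[OF k] show ?thesis by simp
  qed
  then show ?case using recolor_chambers[OF i IH(1) a] eq by (simp add: step_def)
qed

lemma ext_chambers: "x \<in> chambers X \<Longrightarrow> ext x \<in> chambers X"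
  using ext_invariant by blast

lemma perm_ext:
  assumes "i \<in> typeset X" "y \<in> chambers X"
  shows "perm i (lam i y) (lam i (ext y)) \<in> F i"
    "perm i (lam i y) (lam i (ext y)) (lam i y) = lam i (ext y)"
proof -
  have "\<exists>f\<in>F i. f (lam i y) = lam i (ext y)" using ext_invariant assms by blast
  from perm[OF this] show "perm i (lam i y) (lam i (ext y)) \<in> F i"
    "perm i (lam i y) (lam i (ext y)) (lam i y) = lam i (ext y)" .
qed

lemma perm_ext_mem:
  assumes "i \<in> typeset X" "y \<in> chambers X" "x \<in> chambers X"
  shows "perm i (lam i y) (lam i (ext y)) (lam i x) \<in> \<Omega> i"
  by (rule F_mem[OF assms(1) perm_ext(1)[OF assms(1,2)] lam_mem[OF assms(1,3)]])

text \<open>By the diamond property, the choice made by \<open>SOME\<close> in \<open>ext_at\<close> is immaterial.\<close>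

lemma ext_step:
  "i \<in> typeset X \<Longrightarrow> (y, x) \<in> adj X i \<Longrightarrow> level x = Suc (level y) \<Longrightarrow> ext x = step i y x"
proof (induction "level y" arbitrary: i y x rule: less_induct)
  case less
  note i = less.prems(1) and y = less.prems(2) and l = less.prems(3)
  have c: "x \<in> chambers X" "y \<in> chambers X" using adj_chambers y i by blast+
  obtain j z where j: "j \<in> typeset X" and z: "(z, x) \<in> adj X j" "level z = level y"
    and eq: "ext x = step j z x"
    using ext_chosen[OF c(1) l] by metis
  show ?case
  proof (cases "i = j")
    case True
    then have "y = z" using descent_unique[OF i y _ z(2)[symmetric] l] z by blast
    with True eq show ?thesis by simp
  next
    case False
    have lz: "level x = Suc (level z)" using l z by simp
    obtain v where ij: "comm i j" and vy: "(v, y) \<in> adj X j" "level y = Suc (level v)"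
      and vz: "(v, z) \<in> adj X i" "level z = Suc (level v)"
      using diamond[OF i j False y l z(1) lz] .
    have v: "v \<in> chambers X" using adj_chambers vy j by blast
    let ?a = "perm i (lam i v) (lam i (ext v)) (lam i x)"
    let ?b = "perm j (lam j v) (lam j (ext v)) (lam j x)"
    have ab: "?a \<in> \<Omega> i" "?b \<in> \<Omega> j" using perm_ext_mem i j v c by blast+
    have ev: "ext v \<in> chambers X" using ext_chambers v .
    have lt: "level v < level y" using vy by simp
    have "lam j y = lam j x" "lam i z = lam i x" "lam i v = lam i y" "lam j v = lam j z"
      using lam_adj[OF y i j] lam_adj[OF z(1) j i] lam_adj[OF vy(1) j i] lam_adj[OF vz(1) i j]
        False by auto
    moreover from this have ey: "ext y = recolor j ?b (ext v)"
      and ez: "ext z = recolor i ?a (ext v)"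
      using less.hyps[OF lt j vy] less.hyps[OF lt i vz] by (simp_all add: step_def)
    moreover have "lam i (ext y) = lam i (ext v)" "lam j (ext z) = lam j (ext v)"
      using lam_recolor_other[OF j ev ab(2) i] lam_recolor_other[OF i ev ab(1) j] ey ez False
      by simp_all
    \<comment> \<open>All colors that determine the two permutations can be read off at
      \<open>v\<close> and \<open>ext v\<close>, so both routes apply the same two recolorings to
      \<open>ext v\<close>, in opposite orders.\<close>
    ultimately have "step i y x = recolor i ?a (recolor j ?b (ext v))"
      "step j z x = recolor j ?b (recolor i ?a (ext v))"
      by (simp_all add: step_def)
    then show ?thesis using eq recolor_commute[OF ij ev ab] by simp
  qed
qed

section \<open>The extension on a single panel\<close>

text \<open>The formula includes \<open>p\<close> itself, since the permutation sends the color of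
  \<open>p\<close> to that of \<open>ext p\<close>.\<close>

lemma ext_gate_panel:
  assumes i: "i \<in> typeset X" and p: "p \<in> chambers X"
    and l: "\<And>q. (p, q) \<in> adj X i \<Longrightarrow> q \<noteq> p \<Longrightarrow> level q = Suc (level p)"
    and q: "(p, q) \<in> adj X i"
  shows "ext q = recolor i (perm i (lam i p) (lam i (ext p)) (lam i q)) (ext p)"
proof (cases "q = p")
  case True
  then show ?thesis
    using recolor_lam[OF adj_refl] perm_ext ext_chambers i p by simp
next
  case False
  then show ?thesis using ext_step[OF i q l[OF q]] by (simp add: step_def)
qed

text \<open>On a panel inside \<open>C\<close> the map is \<open>g\<close>. Otherwise a shortest
  path from \<open>x\<close> to \<open>C\<close> begins with some type \<open>j\<close> commuting
  with \<open>i\<close>, and on the panel \<open>ext\<close> is a composite of bijections: recolor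
  one level down, apply \<open>ext\<close> there, recolor the image.\<close>

lemma ext_const_panel_bij:
  assumes i: "i \<in> typeset X"
  shows "x \<in> chambers X \<Longrightarrow> (\<And>q. (x, q) \<in> adj X i \<Longrightarrow> level q = level x) \<Longrightarrow>
    bij_betw ext (panel i x) (panel i (ext x))"
proof (induction "level x" arbitrary: x)
  case 0
  note x = "0.prems"(1)
  have C: "q \<in> C" if "(x, q) \<in> adj X i" for q
    using "0.prems"(2)[OF that] "0.hyps" level_eq_0_iff adj_chambers(2)[OF that i] by simp
  have xC: "x \<in> C" using C adj_refl[OF i x] .
  have gb: "bij_betw g (chambers X) (chambers X)" using g by (simp add: Aut_def Bij_def)
  have ga: "(g c, g d) \<in> adj X i \<longleftrightarrow> (c, d) \<in> adj X i"
    if "c \<in> chambers X" "d \<in> chambers X" for c d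
    using g i that by (simp add: Aut_def)
  have "g ` panel i x = panel i (g x)"
  proof (intro equalityI subsetI)
    fix z assume "z \<in> g ` panel i x"
    then show "z \<in> panel i (g x)" using ga x adj_chambers(2)[OF _ i] by auto
  next
    fix z assume z: "z \<in> panel i (g x)"
    then have "z \<in> chambers X" using adj_chambers(2)[OF _ i] by auto
    then obtain d where "d \<in> chambers X" "z = g d" using gb by (auto simp: bij_betw_def)
    then show "z \<in> g ` panel i x" using z ga x by auto
  qed
  moreover have "inj_on g (panel i x)"
    using gb adj_chambers(2)[OF _ i] by (auto simp: bij_betw_def intro: inj_on_subset)
  ultimately have "bij_betw g (panel i x) (panel i (ext x))"
    using ext_C[OF xC] by (simp add: bij_betw_def)
  moreover have "ext q = g q" if "q \<in> panel i x" for q using ext_C C that by simp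
  ultimately show ?case using bij_betw_cong by metis
next
  case (Suc n)
  note x = Suc.prems(1)
  obtain c w where c: "c \<in> C" "path w x c" "length w = level x" using ex_gate x by metis
  then obtain j u y where u: "w = j # u" "j \<in> typeset X" "(x, y) \<in> adj X j" "path u y c"
    using Suc.hyps by (cases w) auto
  have "\<forall>k\<in>set w. comm i k" and iC: "panel i c \<subseteq> C"
    using const_panel[OF i x Suc.prems(2) c(2,3,1)] by blast+
  then have ij: "comm i j" and iu: "\<And>k. k \<in> set u \<Longrightarrow> comm i k" using u by auto
  have t: "i \<noteq> j" using ij comm_irrefl by blast
  have lu: "length u = n" using c u Suc.hyps by simp
  have y: "y \<in> chambers X" "lam j y \<in> \<Omega> j" "lam j x \<in> \<Omega> j"
    using adj_chambers u lam_mem x by blast+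
  have yx: "recolor j (lam j y) x = y" using recolor_lam u by blast
  have ru: "red u" using gate_red[OF c(2,3,1)] u by (simp add: red_Cons_iff)
  \<comment> \<open>Each chamber of the lower panel reaches \<open>C\<close> by the word
    \<open>u\<close>, so its level is at most \<open>n\<close>; its neighbour \<open>q\<close> of
    level \<open>Suc n\<close> forces equality.\<close>
  have down: "level q' = n \<and> level q = Suc (level q')"
    if q: "(x, q) \<in> adj X i" "q' = recolor j (lam j y) q" for q q'
  proof -
    have qc: "q \<in> chambers X" using adj_chambers q i by blast
    have "(y, q') \<in> adj X i"
      using bij_betwE[OF recolor_panel_bij[OF ij x y(2)]] q yx by simp
    moreover have "(q, q') \<in> adj X j" using recolor_adj u qc y q by blast
    moreover obtain d where "path u q' d" "d \<in> C"
    proof -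
      have "comm i k" if "k \<in> set (rev u)" for k using iu that by simp
      from path_commute_panel[OF path_rev[OF u(4)] red_rev[OF ru] i _ \<open>(y, q') \<in> adj X i\<close>, OF this]
      obtain d where d: "(c, d) \<in> adj X i" "path (rev u) d q'" by blast
      then show ?thesis using that path_rev[OF d(2)] iC by auto
    qed
    then have "level q' \<le> n" using level_le lu by blast
    moreover have "level q = Suc n" using Suc q by simp
    ultimately show ?thesis using level_adj u by fastforce
  qed
  have ly: "level y = n" using down[OF adj_refl[OF i x]] yx by simp
  have ny: "level r = level y" if "(y, r) \<in> adj X i" for r
  proof -
    have "r \<in> recolor j (lam j y) ` panel i x"
      using bij_betw_imp_surj_on[OF recolor_panel_bij[OF ij x y(2)]] yx that by simp
    then show ?thesis using down ly by auto
  qed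
  have IH: "bij_betw ext (panel i y) (panel i (ext y))"
    using Suc.hyps(1)[OF ly[symmetric] y(1) ny] .
  have ey: "ext y \<in> chambers X" using ext_chambers y by blast
  let ?b = "perm j (lam j y) (lam j (ext y)) (lam j x)"
  have b: "?b \<in> \<Omega> j" using perm_ext_mem u y x by blast
  \<comment> \<open>One color \<open>?b\<close> serves the whole panel, because
    \<open>j\<close>-colors are constant along the three \<open>i\<close>-panels of
    \<open>x\<close>, \<open>y\<close> and \<open>ext y\<close>.\<close>
  have eq: "ext q = recolor j ?b (ext (recolor j (lam j y) q))" if q: "(x, q) \<in> adj X i" for q
  proof -
    let ?q = "recolor j (lam j y) q"
    have qc: "q \<in> chambers X" using adj_chambers q i by blast
    have yq: "(y, ?q) \<in> adj X i"
      using bij_betwE[OF recolor_panel_bij[OF ij x y(2)]] q yx by simp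
    then have "(ext y, ext ?q) \<in> adj X i" using bij_betwE[OF IH] by simp
    then have "lam j (ext ?q) = lam j (ext y)" "lam j ?q = lam j y" "lam j q = lam j x"
      using lam_adj[of _ _ i j] yq q i u t by metis+
    moreover have "(?q, q) \<in> adj X j" using adj_sym[OF recolor_adj] u qc y by blast
    then have "ext q = step j ?q q" using ext_step[OF u(2)] down[OF q] by blast
    ultimately show ?thesis by (simp add: step_def)
  qed
  have "ext x = recolor j ?b (ext y)" using eq[OF adj_refl[OF i x]] yx by simp
  then have "bij_betw (recolor j ?b \<circ> (ext \<circ> recolor j (lam j y))) (panel i x) (panel i (ext x))"
    using bij_betw_trans[OF bij_betw_trans[OF _ IH] recolor_panel_bij[OF ij ey b]]
      recolor_panel_bij[OF ij x y(2)] yx by simp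
  moreover have "ext q = (recolor j ?b \<circ> (ext \<circ> recolor j (lam j y))) q" if "q \<in> panel i x" for q
    using eq that by simp
  ultimately show ?case using bij_betw_cong by metis
qed

text \<open>In the gate case the map reads off the color, permutes it within \<open>F i\<close> and
  takes the chamber of that color in the image panel.\<close>

lemma ext_panel_bij:
  assumes i: "i \<in> typeset X" and x: "x \<in> chambers X"
  shows "bij_betw ext (panel i x) (panel i (ext x))"
  using i x
proof (cases rule: panel_level_cases)
  case (gate p)
  have p: "p \<in> chambers X" "panel i x = panel i p"
    using adj_chambers(2) gate(1) i panel_eq by blast+
  have l: "level q = Suc (level p)" if "(p, q) \<in> adj X i" "q \<noteq> p" for q
    using gate(2) that p(2) by (metis mem_panel)
  let ?f = "perm i (lam i p) (lam i (ext p))"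
  have ep: "ext p \<in> chambers X" using ext_chambers p by blast
  have f: "bij_betw ?f (\<Omega> i) (\<Omega> i)" using F_Bij[OF i perm_ext(1)[OF i p(1)]] by (simp add: Bij_def)
  have "bij_betw ((\<lambda>a. recolor i a (ext p)) \<circ> (?f \<circ> lam i)) (panel i p) (panel i (ext p))"
    by (rule bij_betw_trans[OF bij_betw_trans[OF lam_bij[OF i p(1)] f] recolor_bij[OF i ep]])
  moreover have "ext q = ((\<lambda>a. recolor i a (ext p)) \<circ> (?f \<circ> lam i)) q" if "q \<in> panel i p" for q
    using ext_gate_panel[OF i p(1) l, of q] that by simp
  ultimately have b: "bij_betw ext (panel i p) (panel i (ext p))" using bij_betw_cong by metis
  have "x \<in> panel i p" using gate(1) adj_sym i by simp
  then have "panel i (ext p) = panel i (ext x)"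
    using bij_betwE[OF b] panel_eq[OF _ i] mem_panel by blast
  with b p show ?thesis by simp
next
  case const
  then show ?thesis using ext_const_panel_bij i x by blast
qed

section \<open>The extension as an automorphism\<close>

lemma ext_path: "path w x y \<Longrightarrow> path w (ext x) (ext y)"
proof (induction w arbitrary: x)
  case (Cons i w)
  then obtain e where e: "i \<in> typeset X" "(x, e) \<in> adj X i" "x \<noteq> e" "path w e y" by auto
  have x: "x \<in> chambers X" using adj_chambers e by blast
  note b = ext_panel_bij[OF e(1) x]
  have "(ext x, ext e) \<in> adj X i" using bij_betwE[OF b] e by simp
  moreover have "ext x \<noteq> ext e"
    using inj_onD[OF bij_betw_imp_inj_on[OF b]] adj_refl[OF e(1) x] e by auto
  ultimately show ?case using Cons.IH[OF e(4)] e by auto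
qed (simp add: ext_chambers)

lemma ext_path_lift:
  "path w (ext x) z \<Longrightarrow> x \<in> chambers X \<Longrightarrow> \<exists>y\<in>chambers X. z = ext y"
proof (induction w arbitrary: x)
  case (Cons i w)
  then obtain e where e: "i \<in> typeset X" "(ext x, e) \<in> adj X i" "path w e z" by auto
  then have "e \<in> ext ` panel i x"
    using bij_betw_imp_surj_on[OF ext_panel_bij] Cons.prems by simp
  then obtain y where "e = ext y" "(x, y) \<in> adj X i" by auto
  then show ?case using Cons.IH e adj_chambers by blast
qed auto

text \<open>If \<open>ext x = ext y\<close>, a reduced type from \<open>x\<close> to
  \<open>y\<close> also joins \<open>ext x\<close> to itself, so it is empty. Surjectivity follows
  by lifting paths step by step through the panel bijections.\<close>

lemma ext_bij: "bij_betw ext (chambers X) (chambers X)"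
  unfolding bij_betw_def
proof (intro conjI equalityI subsetI)
  show "inj_on ext (chambers X)"
  proof (rule inj_onI)
    fix x y assume xy: "x \<in> chambers X" "y \<in> chambers X" and eq: "ext x = ext y"
    obtain w where w: "red w" "path w x y" using ex_red_path xy by blast
    have "path w (ext x) (ext x)" using ext_path[OF w(2)] eq by simp
    moreover have "path [] (ext x) (ext x)" using ext_chambers xy by simp
    ultimately have "eqv w []" using path_unique w red_Nil by blast
    then have "w = []" using eqv_length by force
    with w show "x = y" by simp
  qed
  show "z \<in> chambers X" if "z \<in> ext ` chambers X" for z using that ext_chambers by blast
  show "z \<in> ext ` chambers X" if z: "z \<in> chambers X" for z
  proof -
    obtain x where x: "x \<in> chambers X" using C_nonempty C_chambers by blast
    obtain w where "path w (ext x) z" using ex_red_path ext_chambers[OF x] z by blast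
    from ext_path_lift[OF this x] show ?thesis by blast
  qed
qed

text \<open>Adjacency is reflected because panels map onto panels and \<open>ext\<close> is globally
  injective. The restriction makes the map extensional, as \<open>Bij\<close> demands.\<close>

lemma ext_Aut: "restrict ext (chambers X) \<in> Aut X"
  unfolding Aut_def
proof (intro CollectI conjI ballI)
  show "restrict ext (chambers X) \<in> Bij (chambers X)" using ext_bij by (simp add: Bij_def)
  fix i c d assume i: "i \<in> typeset X" and c: "c \<in> chambers X" and d: "d \<in> chambers X"
  note b = bij_betw_imp_surj_on[OF ext_panel_bij[OF i c]]
  have "(ext c, ext d) \<in> adj X i \<longleftrightarrow> (c, d) \<in> adj X i"
  proof
    assume "(ext c, ext d) \<in> adj X i"
    then have "ext d \<in> ext ` panel i c" using b by simp
    then obtain e where e: "(c, e) \<in> adj X i" "ext d = ext e" by auto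
    have "e \<in> chambers X" using adj_chambers e i by blast
    then have "d = e" using inj_onD[OF bij_betw_imp_inj_on[OF ext_bij] e(2) d] by blast
    with e show "(c, d) \<in> adj X i" by simp
  next
    assume "(c, d) \<in> adj X i"
    then show "(ext c, ext d) \<in> adj X i" using b by auto
  qed
  then show "(restrict ext (chambers X) c, restrict ext (chambers X) d) \<in> adj X i
    \<longleftrightarrow> (c, d) \<in> adj X i" using c d by simp
qed

section \<open>Local actions of the extension\<close>

lemma local_action_gate_panel:
  assumes i: "i \<in> typeset X" and p: "p \<in> chambers X"
    and l: "\<And>q. (p, q) \<in> adj X i \<Longrightarrow> q \<noteq> p \<Longrightarrow> level q = Suc (level p)"
  shows "local_action \<Omega> lam (restrict ext (chambers X)) i (panel i p) \<in> F i"
proof -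
  let ?f = "perm i (lam i p) (lam i (ext p))"
  have f: "?f \<in> F i" using perm_ext i p by blast
  note b = lam_bij[OF i p]
  have "local_action \<Omega> lam (restrict ext (chambers X)) i (panel i p) = restrict ?f (\<Omega> i)"
    unfolding local_action_def
  proof (rule restrict_ext)
    fix a assume a: "a \<in> \<Omega> i"
    define q where "q = inv_into (panel i p) (lam i) a"
    have q: "(p, q) \<in> adj X i" "lam i q = a"
      using bij_betwE[OF bij_betw_inv_into[OF b]] bij_betw_inv_into_right[OF b a] a
      by (auto simp: q_def)
    have "ext q = recolor i (?f a) (ext p)" using ext_gate_panel[OF i p l q(1)] q by simp
    moreover have "q \<in> chambers X" using adj_chambers q i by blast
    ultimately show "(lam i \<circ> restrict ext (chambers X) \<circ> inv_into (panel i p) (lam i)) a = ?f a"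
      using lam_recolor[OF i ext_chambers[OF p] F_mem[OF i f a]] by (simp add: q_def)
  qed
  \<comment> \<open>Members of \<open>F i\<close> are extensional on \<open>\<Omega> i\<close>, so
    restricting changes nothing.\<close>
  also have "\<dots> = ?f" using F_Bij[OF i f] Bij_imp_extensional extensional_restrict by blast
  finally show ?thesis using f by simp
qed

lemma const_panel_parallel:
  assumes i: "i \<in> typeset X" and x: "x \<in> chambers X"
    and const: "\<And>q. (x, q) \<in> adj X i \<Longrightarrow> level q = level x"
  shows "\<exists>P'. is_panel X i P' \<and> P' \<subseteq> C \<and> parallel X (panel i x) P'"
proof -
  obtain c w where c: "c \<in> C" "path w x c" "length w = level x" using ex_gate x by metis
  note w = const_panel[OF i x const c(2,3,1)]
  have "parallel X (panel i x) (panel i c)"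
    using parallel_panels[OF c(2) gate_red[OF c(2,3,1)] i] w(1) by blast
  with w(2) is_panel_panel[OF i C_chambers[OF c(1)]] show ?thesis by blast
qed

lemma parallel_or_local_action:
  assumes i: "i \<in> typeset X" and P: "is_panel X i P"
  shows "(\<exists>j\<in>typeset X. \<exists>P'. is_panel X j P' \<and> P' \<subseteq> C \<and> parallel X P P') \<or>
    local_action \<Omega> lam (restrict ext (chambers X)) i P \<in> F i"
proof -
  obtain x where x: "x \<in> chambers X" "P = panel i x" using P is_panel_iff_panel i by blast
  from i x(1) show ?thesis
  proof (cases rule: panel_level_cases)
    case (gate p)
    have p: "p \<in> chambers X" "P = panel i p"
      using adj_chambers(2)[OF gate(1) i] panel_eq[OF gate(1) i] x(2) by simp_all
    have "level q = Suc (level p)" if "(p, q) \<in> adj X i" "q \<noteq> p" for q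
      using gate(2) that p(2) x(2) by (metis mem_panel)
    from local_action_gate_panel[OF i p(1) this] p(2) show ?thesis by blast
  next
    case const
    from const_panel_parallel[OF i x(1) this] i x(2) show ?thesis by blast
  qed
qed

end

text \<open>Serves the case of empty \<open>C\<close>, where the identity is the required
  automorphism.\<close>

lemma restrict_id_local_action:
  assumes "bij_betw (lam i) P (\<Omega> i)" "P \<subseteq> S"
  shows "local_action \<Omega> lam (\<lambda>x\<in>S. x) i P = (\<lambda>a\<in>\<Omega> i. a)"
  unfolding local_action_def
proof (rule restrict_ext)
  fix a assume a: "a \<in> \<Omega> i"
  have "inv_into P (lam i) a \<in> S"
    using bij_betwE[OF bij_betw_inv_into[OF assms(1)]] assms(2) a by blast
  then show "(lam i \<circ> (\<lambda>x\<in>S. x) \<circ> inv_into P (lam i)) a = a"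
    using bij_betw_inv_into_right[OF assms(1) a] by simp
qed

theorem proposition3p12:
  fixes X :: "('i, 'c) chamber_system"
    and m :: "'i \<Rightarrow> 'i \<Rightarrow> enat"
    and \<Omega> :: "'i \<Rightarrow> 'a set"
    and lam :: "'i \<Rightarrow> 'c \<Rightarrow> 'a"
    and F :: "'i \<Rightarrow> ('a \<Rightarrow> 'a) set"
    and C :: "'c set"
    and g :: "'c \<Rightarrow> 'c"
  assumes "finite (typeset X)"
    and "right_angled_building X m"
    and "semiregular X \<Omega>"
    and "legal_coloring X \<Omega> lam"
    and "panel_closed X C"
    and "local_data (typeset X) \<Omega> F"
    and "g \<in> Aut X"
    and "\<And>c. c \<in> C \<Longrightarrow> harmonious (typeset X) \<Omega> lam F c (g c)"
  shows "\<exists>h \<in> Aut X.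
    (\<forall>c\<in>C. g c = h c) \<and>
    (\<forall>i\<in>typeset X. \<forall>P. is_panel X i P \<longrightarrow>
       (\<exists>j\<in>typeset X. \<exists>P'. is_panel X j P' \<and> P' \<subseteq> C \<and> parallel X P P') \<or>
       local_action \<Omega> lam h i P \<in> F i) \<and>
    (\<forall>c\<in>chambers X. harmonious (typeset X) \<Omega> lam F c (h c))"
proof -
  interpret colored_building X m \<Omega> lam using assms by unfold_locales
  show ?thesis
  proof (cases "C = {}")
    \<comment> \<open>Without chambers in \<open>C\<close> there is no level to recurse on; the
      identity has trivial local actions, which lie in every \<open>F i\<close>.\<close>
    case True
    let ?h = "\<lambda>x\<in>chambers X. x"
    have one: "(\<lambda>a\<in>\<Omega> i. a) \<in> F i" if "i \<in> typeset X" for i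
      using assms(6) that subgroup.one_closed by (fastforce simp: local_data_def BijGroup_def)
    have "?h \<in> Aut X" using id_Bij by (simp add: Aut_def)
    moreover have "local_action \<Omega> lam ?h i P \<in> F i"
      if i: "i \<in> typeset X" and P: "is_panel X i P" for i P
    proof -
      obtain c where c: "c \<in> chambers X" "P = panel i c" using P i is_panel_iff_panel by blast
      have "P \<subseteq> chambers X" using c adj_chambers(2)[OF _ i] by auto
      then show ?thesis
        using restrict_id_local_action[of lam i P \<Omega>] lam_bij[OF i c(1)] c(2) one[OF i] by simp
    qed
    moreover have "harmonious (typeset X) \<Omega> lam F c (?h c)" if c: "c \<in> chambers X" for c
      unfolding harmonious_iff[OF assms(6) c]
      using one lam_mem c by (intro ballI bexI[of _ "\<lambda>a\<in>\<Omega> _. a"]) auto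
    ultimately show ?thesis using True by blast
  next
    case False
    interpret harmonious_automorphism X m C \<Omega> lam F g
      using assms False by unfold_locales
    let ?h = "restrict ext (chambers X)"
    have "\<forall>c\<in>C. g c = ?h c" using ext_C C_chambers by simp
    moreover have "harmonious (typeset X) \<Omega> lam F c (?h c)" if "c \<in> chambers X" for c
      using ext_invariant[OF that] harmonious_iff[OF assms(6) that] that by simp
    ultimately show ?thesis using ext_Aut parallel_or_local_action by blast
  qed
qed

end
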